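(* Let $k$ be a field and $L$ a finite dimensional Hopf algebra over $k$. Then there exists an algebra isomorphism $$\mathcal{H}(L)\cong\mathcal{M}_{\dim(L)}(k),$$ where $\mathcal{H}(L)$ is the Heisenberg double of $L$.
   Context: $\mathcal{M}_n(k)$ is the algebra of $n\times n$ matrices over $k$. For a finite dimensional Hopf algebra $L$, $L^*$ carries the convolution product, and $L$ acts on $L^*$ by $\langle h\cdot g^*,h'\rangle=\langle g^*,h'h\rangle$ for $h,h'\in L$, $g^*\in L^*$. The Heisenberg double $\mathcal{H}(L)=L\#L^*$ is $L\otimes L^*$ as a vector space, with multiplication $(h\#h^* )(g\#g^* )=h_{(2)}g\#h^*(h_{(1)}\cdot g^* )$ (Sweedler notation $\Delta(h)=h_{(1)}\otimes h_{(2)}$) and unit $1_L\#\varepsilon_L$; it is an associative algebra. *)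

theory Defs
  imports "Jordan_Normal_Form.VS_Connect" "HOL-Algebra.QuotRing" "HOL-Library.Poly_Mapping"
begin

section \<open>Unital associative algebras over a field\<close>

text \<open>The ground field is the type \<open>'k\<close> (through \<open>class_ring\<close>); spaces and algebras over it are
  \<open>module\<close> records with a carrier set.  The locale \<open>algebra\<close> of HOL-Algebra requires
  commutativity of the multiplication and is therefore not used.\<close>

locale assoc_algebra = vectorspace class_ring A + ring A
  for A :: "('k::field, 'a, 'm) module_scheme" (structure) +
  assumes smult_mult_left:
    "\<lbrakk>x \<in> carrier A; y \<in> carrier A\<rbrakk> \<Longrightarrow> (c \<odot> x) \<otimes> y = c \<odot> (x \<otimes> y)"
    and smult_mult_right:
    "\<lbrakk>x \<in> carrier A; y \<in> carrier A\<rbrakk> \<Longrightarrow> x \<otimes> (c \<odot> y) = c \<odot> (x \<otimes> y)"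

locale algebra_iso = A: assoc_algebra A + B: assoc_algebra B
  for A :: "('k::field, 'a, 'm) module_scheme"
    and B :: "('k, 'b, 'n) module_scheme"
    and \<phi> :: "'a \<Rightarrow> 'b" +
  assumes ring_iso: "\<phi> \<in> QuotRing.ring_iso A B"
    and linear: "\<phi> \<in> LinearCombinations.module_hom class_ring A B"

definition field_algebra :: "('k::field, 'k) module" where
  "field_algebra = \<lparr>carrier = UNIV, mult = (*), one = 1, zero = 0, add = (+), smult = (*)\<rparr>"


section \<open>Tensor products\<close>

text \<open>As for \<open>func_space\<close> and \<open>direct_sum\<close> in the library, the fields \<open>mult\<close> and \<open>one\<close> of a mere
  vector space carry no information.\<close>

definition free_space :: "'x set \<Rightarrow> ('k::field, 'x \<Rightarrow>\<^sub>0 'k) module" where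
  "free_space S = \<lparr>carrier = {p. Poly_Mapping.keys p \<subseteq> S}, mult = (\<lambda>p q. 0), one = 0,
     zero = 0, add = (+), smult = (\<lambda>c. Poly_Mapping.map ((*) c))\<rparr>"

definition tensor_relators ::
  "('k::field, 'u, 'm) module_scheme \<Rightarrow> ('k, 'v, 'n) module_scheme \<Rightarrow> ('u \<times> 'v \<Rightarrow>\<^sub>0 'k) set" where
  "tensor_relators U V =
     {Poly_Mapping.single (u \<oplus>\<^bsub>U\<^esub> u', v) 1 - Poly_Mapping.single (u, v) 1
        - Poly_Mapping.single (u', v) 1 | u u' v.
        u \<in> carrier U \<and> u' \<in> carrier U \<and> v \<in> carrier V} \<union>
     {Poly_Mapping.single (u, v \<oplus>\<^bsub>V\<^esub> v') 1 - Poly_Mapping.single (u, v) 1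
        - Poly_Mapping.single (u, v') 1 | u v v'.
        u \<in> carrier U \<and> v \<in> carrier V \<and> v' \<in> carrier V} \<union>
     {Poly_Mapping.single (c \<odot>\<^bsub>U\<^esub> u, v) 1 - Poly_Mapping.single (u, v) c | c u v.
        u \<in> carrier U \<and> v \<in> carrier V} \<union>
     {Poly_Mapping.single (u, c \<odot>\<^bsub>V\<^esub> v) 1 - Poly_Mapping.single (u, v) c | c u v.
        u \<in> carrier U \<and> v \<in> carrier V}"

definition tensor_kernel ::
  "('k::field, 'u, 'm) module_scheme \<Rightarrow> ('k, 'v, 'n) module_scheme \<Rightarrow> ('u \<times> 'v \<Rightarrow>\<^sub>0 'k) set" where
  "tensor_kernel U V = LinearCombinations.module.span class_ring
     (free_space (carrier U \<times> carrier V)) (tensor_relators U V)"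

type_synonym ('u, 'v, 'k) tensor = "('u \<times> 'v \<Rightarrow>\<^sub>0 'k) set"

definition tensor_space ::
  "('k::field, 'u, 'm) module_scheme \<Rightarrow> ('k, 'v, 'n) module_scheme
     \<Rightarrow> ('k, ('u, 'v, 'k) tensor) module" where
  "tensor_space U V =
     (let F = free_space (carrier U \<times> carrier V); N = tensor_kernel U V in
      \<lparr>carrier = (a_rcosets\<^bsub>F\<^esub> N), mult = (\<lambda>s t. N), one = N, zero = N,
       add = (\<lambda>s t. s <+>\<^bsub>F\<^esub> t), smult = (\<lambda>c s. \<Union>p\<in>s. N +>\<^bsub>F\<^esub> (c \<odot>\<^bsub>F\<^esub> p))\<rparr>)"

definition pure_tensor ::
  "('k::field, 'u, 'm) module_scheme \<Rightarrow> ('k, 'v, 'n) module_scheme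
     \<Rightarrow> 'u \<Rightarrow> 'v \<Rightarrow> ('u, 'v, 'k) tensor" where
  "pure_tensor U V u v =
     tensor_kernel U V +>\<^bsub>free_space (carrier U \<times> carrier V)\<^esub> Poly_Mapping.single (u, v) 1"

text \<open>The linear map out of a tensor product induced by a bilinear map \<open>f\<close> into \<open>W\<close>: on a coset
  it is the common value of the linear extension of \<open>f\<close> to the free space; hence it is meaningful only
  for bilinear \<open>f\<close>.  Sweedler notation \<open>f h\<^sub>(\<^sub>1\<^sub>) h\<^sub>(\<^sub>2\<^sub>)\<close> is rendered
  \<open>tensor_lift W f (comult L h)\<close>.\<close>

definition tensor_lift ::
  "('k::field, 'w, 'm) module_scheme \<Rightarrow> ('u \<Rightarrow> 'v \<Rightarrow> 'w) \<Rightarrow> ('u, 'v, 'k) tensor \<Rightarrow> 'w" where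
  "tensor_lift W f t = the_elem ((\<lambda>p. \<Oplus>\<^bsub>W\<^esub>x\<in>Poly_Mapping.keys p.
     Poly_Mapping.lookup p x \<odot>\<^bsub>W\<^esub> f (fst x) (snd x)) ` t)"

definition tensor_algebra ::
  "('k::field, 'a, 'm) module_scheme \<Rightarrow> ('k, 'b, 'n) module_scheme
     \<Rightarrow> ('k, ('a, 'b, 'k) tensor) module" where
  "tensor_algebra A B = (let T = tensor_space A B in
     T\<lparr>mult := (\<lambda>s t. tensor_lift T (\<lambda>a b. tensor_lift T (\<lambda>a' b'.
           pure_tensor A B (a \<otimes>\<^bsub>A\<^esub> a') (b \<otimes>\<^bsub>B\<^esub> b')) t) s),
       one := pure_tensor A B \<one>\<^bsub>A\<^esub> \<one>\<^bsub>B\<^esub>\<rparr>)"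


section \<open>Hopf algebras\<close>

record (overloaded) ('k::zero, 'a) hopf = "('k, 'a) module" +
  comult :: "'a \<Rightarrow> ('a, 'a, 'k) tensor"
  counit :: "'a \<Rightarrow> 'k"
  antipode :: "'a \<Rightarrow> 'a"

text \<open>In \<open>coassoc\<close> both sides lie in \<open>L \<otimes> (L \<otimes> L)\<close>; the left-hand side is
  \<open>(\<Delta> \<otimes> id) \<circ> \<Delta>\<close> followed by the canonical isomorphism from \<open>(L \<otimes> L) \<otimes> L\<close>.\<close>

locale hopf_algebra = assoc_algebra L
  for L :: "('k::field, 'a, 'm) hopf_scheme" (structure) +
  assumes comult_hom: "comult L \<in> Ring.ring_hom L (tensor_algebra L L)"
    and comult_linear: "comult L \<in> LinearCombinations.module_hom class_ring L (tensor_space L L)"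
    and counit_hom: "counit L \<in> Ring.ring_hom L field_algebra"
    and counit_linear: "counit L \<in> LinearCombinations.module_hom class_ring L field_algebra"
    and antipode_linear: "antipode L \<in> LinearCombinations.module_hom class_ring L L"
    and coassoc: "h \<in> carrier L \<Longrightarrow>
      tensor_lift (tensor_space L (tensor_space L L))
        (\<lambda>x y. tensor_lift (tensor_space L (tensor_space L L))
           (\<lambda>x1 x2. pure_tensor L (tensor_space L L) x1 (pure_tensor L L x2 y)) (comult L x))
        (comult L h) =
      tensor_lift (tensor_space L (tensor_space L L))
        (\<lambda>x y. pure_tensor L (tensor_space L L) x (comult L y)) (comult L h)"
    and counit_left: "h \<in> carrier L \<Longrightarrow> tensor_lift L (\<lambda>x y. counit L x \<odot> y) (comult L h) = h"
    and counit_right: "h \<in> carrier L \<Longrightarrow> tensor_lift L (\<lambda>x y. counit L y \<odot> x) (comult L h) = h"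
    and antipode_left: "h \<in> carrier L \<Longrightarrow>
      tensor_lift L (\<lambda>x y. antipode L x \<otimes> y) (comult L h) = counit L h \<odot> \<one>"
    and antipode_right: "h \<in> carrier L \<Longrightarrow>
      tensor_lift L (\<lambda>x y. x \<otimes> antipode L y) (comult L h) = counit L h \<odot> \<one>"


section \<open>The dual algebra and the Heisenberg double\<close>

text \<open>Functionals are represented by functions that are \<open>undefined\<close> outside the carrier, so that
  equality of functionals is equality in HOL; the multiplication is the convolution product.\<close>

definition dual_algebra :: "('k::field, 'a, 'm) hopf_scheme \<Rightarrow> ('k, 'a \<Rightarrow> 'k) module" where
  "dual_algebra L = \<lparr>
     carrier = LinearCombinations.module_hom class_ring L field_algebra \<inter> extensional (carrier L),
     mult = (\<lambda>f g. \<lambda>h\<in>carrier L. tensor_lift field_algebra (\<lambda>x y. f x * g y) (comult L h)),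
     one = restrict (counit L) (carrier L),
     zero = (\<lambda>h\<in>carrier L. 0),
     add = (\<lambda>f g. \<lambda>h\<in>carrier L. f h + g h),
     smult = (\<lambda>c f. \<lambda>h\<in>carrier L. c * f h)\<rparr>"

definition dual_action ::
  "('k::field, 'a, 'm) hopf_scheme \<Rightarrow> 'a \<Rightarrow> ('a \<Rightarrow> 'k) \<Rightarrow> ('a \<Rightarrow> 'k)" where
  "dual_action L h g = (\<lambda>h'\<in>carrier L. g (h' \<otimes>\<^bsub>L\<^esub> h))"

definition heisenberg_double ::
  "('k::field, 'a, 'm) hopf_scheme \<Rightarrow> ('k, ('a, 'a \<Rightarrow> 'k, 'k) tensor) module" where
  "heisenberg_double L = (let D = dual_algebra L; T = tensor_space L D in
     T\<lparr>mult := (\<lambda>s t.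
         tensor_lift T (\<lambda>h f.
           tensor_lift T (\<lambda>g f'.
             tensor_lift T (\<lambda>h1 h2.
               pure_tensor L D (h2 \<otimes>\<^bsub>L\<^esub> g) (f \<otimes>\<^bsub>D\<^esub> dual_action L h1 f'))
             (comult L h)) t) s),
       one := pure_tensor L D \<one>\<^bsub>L\<^esub> \<one>\<^bsub>D\<^esub>\<rparr>)"

end

theory Submission
  imports Defs
begin

text \<open>The Heisenberg double acts on the dual space by \<open>(h # f) \<cdot> g = f * (h \<cdot> g)\<close>, where \<open>*\<close> is
  convolution and \<open>(h \<cdot> g) x = g (x h)\<close>.  This is an action because \<open>L\<^sup>*\<close> is a module algebra:
  \<open>h \<cdot> (f g) = (h\<^sub>1 \<cdot> f) (h\<^sub>2 \<cdot> g)\<close>, which is multiplicativity of the comultiplication read on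
  functionals.  In a basis \<open>e\<^sub>i\<close> of \<open>L\<close> with dual basis \<open>c\<^sub>i\<close> the action becomes a homomorphism
  \<open>rep\<close> into the \<open>n \<times> n\<close> matrices (\<open>rep_mult\<close>, \<open>rep_one\<close>), and the claim is that it is bijective.
  The Heisenberg double has dimension at most \<open>n\<^sup>2\<close> and the matrices have dimension \<open>n\<^sup>2\<close>, so
  surjectivity suffices (\<open>rep_injective\<close>); the algebra axioms for the Heisenberg double are then pulled back
  along \<open>rep\<close> (\<open>assoc_algebra_transport\<close>).

  Surjectivity (\<open>rep_surjective\<close>) is the substantial point.  A formula for the inverse would
  involve the inverse of the antipode, whose existence is itself a theorem about finite dimension;
  the following argument uses finite dimension directly.  Let \<open>A\<close> be the image of \<open>rep\<close> and let
  \<open>P\<close> be the matrix over \<open>A\<close> with entries \<open>P\<^sub>j\<^sub>i = rep (e\<^sub>j # c\<^sub>i)\<close>.  It encodes the Galois map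
  \<open>x \<otimes> y \<mapsto> x\<^sub>1 \<otimes> x\<^sub>2 y\<close>, whose inverse \<open>x \<otimes> y \<mapsto> x\<^sub>1 \<otimes> S x\<^sub>2 y\<close> shows that \<open>P\<close> has a right
  inverse over all matrices.  Hence \<open>G \<mapsto> G P\<close> is injective on the rows with entries in \<open>A\<close>.  These
  rows form a finite-dimensional space, so the map is onto (\<open>block_row_equation_solvable\<close>).

  On the coordinate vector of the counit, \<open>P\<^sub>j\<^sub>i\<close> takes the value \<open>\<epsilon> e\<^sub>j\<close> times the \<open>i\<close>-th unit vector,
  while \<open>R = rep (1 # c\<^sub>a)\<close> gives the \<open>a\<close>-th unit vector.  Solving \<open>G P = Y\<close> with \<open>Y\<^sub>i = R\<close> for \<open>i = b\<close>
  and \<open>Y\<^sub>i = 0\<close> otherwise, and evaluating at the counit, exhibits the matrix unit at \<open>(a, b)\<close> as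
  \<open>\<Sum>\<^sub>j \<epsilon> e\<^sub>j G\<^sub>j\<close>, an element of \<open>A\<close> (\<open>full_matrix_algebraI\<close>).

  All identities in Hopf algebras are checked on scalar-valued forms: \<open>sweedler F h\<close> stands for
  \<open>F h\<^sub>1 h\<^sub>2\<close>, and the universal property of the tensor product turns each axiom into a rule for it.\<close>

section \<open>Linear and bilinear maps\<close>

abbreviation linear_maps where
  "linear_maps U V \<equiv> LinearCombinations.module_hom class_ring U V"

definition bilinear where
  "bilinear U V W f \<longleftrightarrow> (\<forall>u\<in>carrier U. f u \<in> linear_maps V W) \<and>
     (\<forall>v\<in>carrier V. (\<lambda>u. f u v) \<in> linear_maps U W)"

lemma linear_mapsI:
  assumes "\<And>u. u \<in> carrier U \<Longrightarrow> f u \<in> carrier V"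
    and "\<And>u u'. \<lbrakk>u \<in> carrier U; u' \<in> carrier U\<rbrakk> \<Longrightarrow> f (u \<oplus>\<^bsub>U\<^esub> u') = f u \<oplus>\<^bsub>V\<^esub> f u'"
    and "\<And>c u. u \<in> carrier U \<Longrightarrow> f (c \<odot>\<^bsub>U\<^esub> u) = c \<odot>\<^bsub>V\<^esub> f u"
  shows "f \<in> linear_maps U V"
  using assms by (auto simp: LinearCombinations.module_hom_def)

lemma linear_mapsD:
  assumes "f \<in> linear_maps U V"
  shows "u \<in> carrier U \<Longrightarrow> f u \<in> carrier V"
    and "\<lbrakk>u \<in> carrier U; u' \<in> carrier U\<rbrakk> \<Longrightarrow> f (u \<oplus>\<^bsub>U\<^esub> u') = f u \<oplus>\<^bsub>V\<^esub> f u'"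
    and "u \<in> carrier U \<Longrightarrow> f (c \<odot>\<^bsub>U\<^esub> u) = c \<odot>\<^bsub>V\<^esub> f u"
  using assms by (auto simp: LinearCombinations.module_hom_def)

lemma linear_maps_comp:
  assumes "f \<in> linear_maps U V" "g \<in> linear_maps V W"
  shows "(\<lambda>u. g (f u)) \<in> linear_maps U W"
  using assms by (auto simp: LinearCombinations.module_hom_def Pi_iff)

lemma linear_maps_cong:
  assumes "f \<in> linear_maps U V" "\<And>u. u \<in> carrier U \<Longrightarrow> f u = g u" "module class_ring U"
  shows "g \<in> linear_maps U V"
proof -
  interpret U: Module.module class_ring U by fact
  have "u \<oplus>\<^bsub>U\<^esub> u' \<in> carrier U" "c \<odot>\<^bsub>U\<^esub> u \<in> carrier U" if "u \<in> carrier U" "u' \<in> carrier U" for u u' c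
    using that by auto
  then show ?thesis
    using assms(1,2) by (auto simp: LinearCombinations.module_hom_def Pi_iff)
qed

lemma bilinearI:
  assumes "\<And>u. u \<in> carrier U \<Longrightarrow> f u \<in> linear_maps V W"
    and "\<And>v. v \<in> carrier V \<Longrightarrow> (\<lambda>u. f u v) \<in> linear_maps U W"
  shows "bilinear U V W f"
  using assms by (simp add: bilinear_def)

lemma bilinearD:
  assumes "bilinear U V W f"
  shows "u \<in> carrier U \<Longrightarrow> f u \<in> linear_maps V W"
    and "v \<in> carrier V \<Longrightarrow> (\<lambda>u. f u v) \<in> linear_maps U W"
  using assms by (simp_all add: bilinear_def)

lemma bilinear_closed:
  "\<lbrakk>bilinear U V W f; u \<in> carrier U; v \<in> carrier V\<rbrakk> \<Longrightarrow> f u v \<in> carrier W"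
  by (rule linear_mapsD(1)[OF bilinearD(1)])

lemma bilinear_comp:
  assumes "bilinear U V W f" "g \<in> linear_maps W X"
  shows "bilinear U V X (\<lambda>u v. g (f u v))"
  by (intro bilinearI linear_maps_comp[OF bilinearD(1)[OF assms(1)] assms(2)]
      linear_maps_comp[OF bilinearD(2)[OF assms(1)] assms(2)])

lemma submodule_eqI:
  assumes "submodule class_ring N U" "carrier U \<subseteq> N"
  shows "N = carrier U"
  using assms by (simp add: submodule_def subset_antisym)

lemma linear_maps_zero:
  assumes "module class_ring U" "module class_ring V" "f \<in> linear_maps U V"
  shows "f \<zero>\<^bsub>U\<^esub> = \<zero>\<^bsub>V\<^esub>"
proof -
  interpret mod_hom class_ring U V f
    by (intro mod_hom.intro mod_hom_axioms.intro assms)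
  show ?thesis by simp
qed

lemma linear_maps_preimage_submodule:
  assumes "module class_ring U" "module class_ring V" "f \<in> linear_maps U V" "submodule class_ring N V"
  shows "submodule class_ring {u \<in> carrier U. f u \<in> N} U"
proof -
  interpret U: Module.module class_ring U by fact
  interpret V: Module.module class_ring V by fact
  interpret N: LinearCombinations.submodule class_ring N V by fact
  have 0: "f \<zero>\<^bsub>U\<^esub> = \<zero>\<^bsub>V\<^esub>"
    by (intro linear_maps_zero assms)
  show ?thesis
    using N.m_closed N.zero_closed N.smult_closed
    by (auto intro!: LinearCombinations.submodule.intro simp: 0 linear_mapsD[OF assms(3)] assms(1))
qed

lemma linear_maps_equalizer:
  assumes "module class_ring U" "module class_ring V" "f \<in> linear_maps U V" "g \<in> linear_maps U V"
  shows "submodule class_ring {u \<in> carrier U. f u = g u} U"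
proof -
  interpret U: Module.module class_ring U by fact
  interpret V: Module.module class_ring V by fact
  have 0: "f \<zero>\<^bsub>U\<^esub> = \<zero>\<^bsub>V\<^esub>" "g \<zero>\<^bsub>U\<^esub> = \<zero>\<^bsub>V\<^esub>"
    by (intro linear_maps_zero assms)+
  show ?thesis
    by (auto intro!: LinearCombinations.submodule.intro
       simp: 0 linear_mapsD[OF assms(3)] linear_mapsD[OF assms(4)] assms(1))
qed

section \<open>The free space and linear extensions\<close>

lemma lookup_scale: "Poly_Mapping.lookup (Poly_Mapping.map ((*) c) p) x = c * Poly_Mapping.lookup p x"
  for c :: "'k::field"
  by (simp add: map.rep_eq when_def)

lemma module_free_space: "module class_ring (free_space S :: ('k::field, 'x \<Rightarrow>\<^sub>0 'k) module)"
proof (rule module_criteria)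
  have keys_smult: "Poly_Mapping.keys (Poly_Mapping.map ((*) c) p) \<subseteq> Poly_Mapping.keys p" for c :: 'k and p :: "'x \<Rightarrow>\<^sub>0 'k"
    by transfer (auto simp: when_def)
  show "cring (class_ring :: 'k ring)" ..
  show "\<forall>c v. c \<in> carrier class_ring \<and> v \<in> carrier (free_space S) \<longrightarrow>
     c \<odot>\<^bsub>free_space S\<^esub> v \<in> carrier (free_space S :: ('k, 'x \<Rightarrow>\<^sub>0 'k) module)"
    by (simp add: free_space_def) (meson keys_smult subset_trans)
  show "\<forall>v w. v \<in> carrier (free_space S :: ('k, 'x \<Rightarrow>\<^sub>0 'k) module) \<and> w \<in> carrier (free_space S) \<longrightarrow>
      v \<oplus>\<^bsub>free_space S\<^esub> w \<in> carrier (free_space S)"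
    using keys_add by (fastforce simp: free_space_def)
  show "\<forall>v\<in>carrier (free_space S :: ('k, 'x \<Rightarrow>\<^sub>0 'k) module).
       \<exists>neg_v\<in>carrier (free_space S). v \<oplus>\<^bsub>free_space S\<^esub> neg_v = \<zero>\<^bsub>free_space S\<^esub>"
    by (auto simp: free_space_def intro!: exI[of _ "- _"])
qed (auto simp: free_space_def lookup_add lookup_scale algebra_simps intro!: poly_mapping_eqI)

lemma free_space_simps:
  "carrier (free_space S) = {p. Poly_Mapping.keys p \<subseteq> S}"
  "\<zero>\<^bsub>free_space S\<^esub> = 0"
  "p \<oplus>\<^bsub>free_space S\<^esub> q = p + q"
  "c \<odot>\<^bsub>free_space S\<^esub> p = Poly_Mapping.map ((*) c) p"
  by (simp_all add: free_space_def)

lemma scale_single: "Poly_Mapping.map ((*) c) (Poly_Mapping.single x d) = Poly_Mapping.single x (c * d)"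
  for c :: "'k::field"
  by (rule poly_mapping_eqI) (simp add: lookup_scale lookup_single when_def)

lemma sum_singles: "(\<Sum>a\<in>Poly_Mapping.keys p. Poly_Mapping.single a (Poly_Mapping.lookup p a)) = p"
  by (rule poly_mapping_eqI)
    (auto simp: lookup_sum lookup_single when_def sum.delta Poly_Mapping.in_keys_iff)

text \<open>Linear statements about the free space may be checked on its generators.\<close>

lemma free_space_submodule_full:
  fixes S :: "'x set"
  assumes "submodule (class_ring :: 'k::field ring) N (free_space S)"
    and "\<And>x. x \<in> S \<Longrightarrow> Poly_Mapping.single x 1 \<in> N"
  shows "N = carrier (free_space S)"
proof (rule submodule_eqI[OF assms(1)], rule subsetI)
  interpret N: LinearCombinations.submodule "class_ring :: 'k ring" N "free_space S" by (rule assms(1))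
  fix p :: "'x \<Rightarrow>\<^sub>0 'k" assume p: "p \<in> carrier (free_space S)"
  have "(\<Sum>a\<in>A. Poly_Mapping.single a (Poly_Mapping.lookup p a)) \<in> N" if "finite A" "A \<subseteq> S" for A
    using that
  proof (induction A)
    case empty
    show ?case using N.zero_closed by (simp add: free_space_simps)
  next
    case (insert a A)
    have "Poly_Mapping.single a (Poly_Mapping.lookup p a) \<in> N"
      using N.smult_closed[of "Poly_Mapping.lookup p a" "Poly_Mapping.single a 1"] assms(2)[of a] insert.prems
      by (simp add: free_space_simps scale_single)
    then show ?case
      using N.m_closed[of "Poly_Mapping.single a (Poly_Mapping.lookup p a)"] insert
      by (simp add: free_space_simps)
  qed
  from this[of "Poly_Mapping.keys p"] p show "p \<in> N"
    by (simp add: free_space_simps sum_singles)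
qed

text \<open>The value that \<open>tensor_lift\<close> reads off at a representative of a coset.\<close>

definition linear_extension where
  "linear_extension W f p =
     (\<Oplus>\<^bsub>W\<^esub>x\<in>Poly_Mapping.keys p. Poly_Mapping.lookup p x \<odot>\<^bsub>W\<^esub> f (fst x) (snd x))"

lemma linear_extension_superset:
  assumes "module class_ring W" "finite A" "Poly_Mapping.keys p \<subseteq> A"
    and "\<And>x. x \<in> A \<Longrightarrow> f (fst x) (snd x) \<in> carrier W"
  shows "linear_extension W f p = (\<Oplus>\<^bsub>W\<^esub>x\<in>A. Poly_Mapping.lookup p x \<odot>\<^bsub>W\<^esub> f (fst x) (snd x))"
proof -
  interpret W: Module.module class_ring W by fact
  show ?thesis
    unfolding linear_extension_def using assms(2-4)
    by (intro W.add.finprod_mono_neutral_cong_left) (auto simp: Poly_Mapping.in_keys_iff W.lmult_0[simplified])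
qed

lemma linear_extension_single:
  assumes "module class_ring W" "f u v \<in> carrier W"
  shows "linear_extension W f (Poly_Mapping.single (u, v) c) = c \<odot>\<^bsub>W\<^esub> f u v"
proof -
  interpret W: Module.module class_ring W by fact
  have "linear_extension W f (Poly_Mapping.single (u, v) c)
      = (\<Oplus>\<^bsub>W\<^esub>x\<in>{(u, v)}. Poly_Mapping.lookup (Poly_Mapping.single (u, v) c) x \<odot>\<^bsub>W\<^esub> f (fst x) (snd x))"
    using assms by (intro linear_extension_superset) auto
  also have "\<dots> = c \<odot>\<^bsub>W\<^esub> f u v"
    using assms(2) by simp
  finally show ?thesis .
qed

lemma linear_extension_linear:
  fixes W :: "('k::field, 'w, 'm) module_scheme"
  assumes "module class_ring W" "\<And>x. x \<in> S \<Longrightarrow> f (fst x) (snd x) \<in> carrier W"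
  shows "linear_extension W f \<in> linear_maps (free_space S) W"
proof (rule linear_mapsI)
  interpret W: Module.module class_ring W by fact
  let ?sum = "\<lambda>A p. (\<Oplus>\<^bsub>W\<^esub>x\<in>A. Poly_Mapping.lookup p x \<odot>\<^bsub>W\<^esub> f (fst x) (snd x))"
  have ext: "linear_extension W f p = ?sum A p"
    if "finite A" "A \<subseteq> S" "Poly_Mapping.keys p \<subseteq> A" for p A
    using that assms by (intro linear_extension_superset) auto
  fix p q :: "'a \<times> 'b \<Rightarrow>\<^sub>0 'k" and c assume p: "p \<in> carrier (free_space S)"
  show "linear_extension W f p \<in> carrier W"
    unfolding linear_extension_def
    by (rule W.finsum_closed) (use p assms(2) in \<open>auto simp: free_space_simps\<close>)
  show "linear_extension W f (c \<odot>\<^bsub>free_space S\<^esub> p) = c \<odot>\<^bsub>W\<^esub> linear_extension W f p"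
  proof -
    have "linear_extension W f (c \<odot>\<^bsub>free_space S\<^esub> p) = ?sum (Poly_Mapping.keys p) (c \<odot>\<^bsub>free_space S\<^esub> p)"
      using p by (intro ext) (auto simp: free_space_simps Poly_Mapping.in_keys_iff lookup_scale)
    also have "\<dots> = (\<Oplus>\<^bsub>W\<^esub>x\<in>Poly_Mapping.keys p. c \<odot>\<^bsub>W\<^esub> (Poly_Mapping.lookup p x \<odot>\<^bsub>W\<^esub> f (fst x) (snd x)))"
      using p assms(2) by (intro W.finsum_cong') (auto simp: free_space_simps lookup_scale W.smult_assoc1[simplified])
    also have "\<dots> = c \<odot>\<^bsub>W\<^esub> linear_extension W f p"
      unfolding linear_extension_def using p assms(2)
      by (subst W.finsum_smult) (auto simp: free_space_simps)
    finally show ?thesis .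
  qed
  assume q: "q \<in> carrier (free_space S)"
  let ?A = "Poly_Mapping.keys p \<union> Poly_Mapping.keys q"
  have A: "finite ?A" "?A \<subseteq> S" using p q by (auto simp: free_space_simps)
  have "linear_extension W f (p \<oplus>\<^bsub>free_space S\<^esub> q) = ?sum ?A (p + q)"
    using A Poly_Mapping.keys_add[of p q] by (subst ext[of ?A]) (auto simp: free_space_simps)
  also have "\<dots> = (\<Oplus>\<^bsub>W\<^esub>x\<in>?A. Poly_Mapping.lookup p x \<odot>\<^bsub>W\<^esub> f (fst x) (snd x)
       \<oplus>\<^bsub>W\<^esub> Poly_Mapping.lookup q x \<odot>\<^bsub>W\<^esub> f (fst x) (snd x))"
    using A assms(2) by (intro W.finsum_cong') (auto simp: lookup_add W.smult_l_distr[simplified])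
  also have "\<dots> = ?sum ?A p \<oplus>\<^bsub>W\<^esub> ?sum ?A q"
    using A assms(2) by (intro W.finsum_addf) auto
  also have "\<dots> = linear_extension W f p \<oplus>\<^bsub>W\<^esub> linear_extension W f q"
    using A by (subst (1 2) ext[of ?A]) auto
  finally show "linear_extension W f (p \<oplus>\<^bsub>free_space S\<^esub> q)
      = linear_extension W f p \<oplus>\<^bsub>W\<^esub> linear_extension W f q" .
qed

lemma tensor_lift_eq: "tensor_lift W f t = the_elem (linear_extension W f ` t)"
  by (simp add: tensor_lift_def linear_extension_def[abs_def])

section \<open>Tensor products and their universal property\<close>

locale tensor_factors = U: Module.module class_ring U + V: Module.module class_ring V
  for U :: "('k::field, 'u, 'm) module_scheme" and V :: "('k, 'v, 'n) module_scheme"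
begin

abbreviation "F \<equiv> free_space (carrier U \<times> carrier V) :: ('k, 'u \<times> 'v \<Rightarrow>\<^sub>0 'k) module"
abbreviation "T \<equiv> tensor_space U V"

text \<open>The quotient map from the free space onto the tensor product.\<close>

definition tclass :: "('u \<times> 'v \<Rightarrow>\<^sub>0 'k) \<Rightarrow> ('u, 'v, 'k) tensor" where
  "tclass p = tensor_kernel U V +>\<^bsub>F\<^esub> p"

sublocale F: Module.module class_ring F
  by (rule module_free_space)

lemma relators_subset: "tensor_relators U V \<subseteq> carrier F"
proof -
  have *: "Poly_Mapping.single x a - Poly_Mapping.single y b \<in> carrier F" if "x \<in> carrier U \<times> carrier V" "y \<in> carrier U \<times> carrier V" for x y a b
    using that keys_diff[of "Poly_Mapping.single x a" "Poly_Mapping.single y b"]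
    by (auto simp: free_space_simps split: if_splits)
  have **: "p - Poly_Mapping.single y b \<in> carrier F" if "p \<in> carrier F" "y \<in> carrier U \<times> carrier V" for p y b
    using that keys_diff[of p "Poly_Mapping.single y b"]
    by (auto simp: free_space_simps split: if_splits)
  have "Poly_Mapping.single x c \<in> carrier F" if "x \<in> carrier U \<times> carrier V" for x c
    using that by (auto simp: free_space_simps)
  note * = this *
  have "c \<odot>\<^bsub>U\<^esub> u \<in> carrier U" if "u \<in> carrier U" for c u using that U.smult_closed[of c] by simp
  moreover have "c \<odot>\<^bsub>V\<^esub> u \<in> carrier V" if "u \<in> carrier V" for c u using that V.smult_closed[of c] by simp
  ultimately show ?thesis
    unfolding tensor_relators_def by (auto intro!: * **)
qed

lemma kernel_submodule: "submodule class_ring (tensor_kernel U V) F"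
  unfolding tensor_kernel_def by (rule F.span_is_submodule[OF relators_subset])

sublocale N: LinearCombinations.submodule class_ring "tensor_kernel U V" F
  by (rule kernel_submodule)

lemma kernel_diff: "\<lbrakk>p \<in> tensor_kernel U V; q \<in> tensor_kernel U V\<rbrakk> \<Longrightarrow> p - q \<in> tensor_kernel U V"
proof -
  assume pq: "p \<in> tensor_kernel U V" "q \<in> tensor_kernel U V"
  have "p \<oplus>\<^bsub>F\<^esub> (- 1) \<odot>\<^bsub>F\<^esub> q = p - q"
    by (rule poly_mapping_eqI) (simp add: free_space_simps lookup_scale lookup_add lookup_minus)
  then show ?thesis using N.m_closed[OF pq(1) N.smult_closed[OF _ pq(2), of "- 1"]] by simp
qed

lemma kernel_add: "\<lbrakk>p \<in> tensor_kernel U V; q \<in> tensor_kernel U V\<rbrakk> \<Longrightarrow> p + q \<in> tensor_kernel U V"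
  using N.m_closed by (simp add: free_space_simps)

lemma kernel_zero: "0 \<in> tensor_kernel U V"
  using N.zero_closed by (simp add: free_space_simps)

lemma tclass_conv: "tclass p = {n + p | n. n \<in> tensor_kernel U V}"
  by (auto simp: tclass_def a_r_coset_def' free_space_simps)

lemma mem_tclass: "q \<in> tclass p \<longleftrightarrow> q - p \<in> tensor_kernel U V"
proof
  assume "q - p \<in> tensor_kernel U V"
  moreover have "q = (q - p) + p" by simp
  ultimately show "q \<in> tclass p" unfolding tclass_conv by blast
qed (auto simp: tclass_conv)

lemma tclass_eq_iff: "tclass p = tclass q \<longleftrightarrow> p - q \<in> tensor_kernel U V"
proof
  assume "tclass p = tclass q"
  moreover have "p \<in> tclass p" using kernel_zero by (simp add: mem_tclass)
  ultimately show "p - q \<in> tensor_kernel U V" by (simp add: mem_tclass)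
next
  assume pq: "p - q \<in> tensor_kernel U V"
  have "r - p \<in> tensor_kernel U V \<longleftrightarrow> r - q \<in> tensor_kernel U V" for r
    using kernel_add[of "r - p" "p - q"] kernel_diff[of "r - q" "p - q"] pq by auto
  then show "tclass p = tclass q" by (auto simp: mem_tclass)
qed

lemma carrier_tensor_space: "carrier T = tclass ` carrier F"
  by (auto simp: tensor_space_def Let_def A_RCOSETS_def' tclass_def)

lemma tensor_space_add: "tclass p \<oplus>\<^bsub>T\<^esub> tclass q = tclass (p \<oplus>\<^bsub>F\<^esub> q)"
proof -
  have "tclass p <+>\<^bsub>F\<^esub> tclass q = tclass (p + q)"
  proof (intro equalityI subsetI)
    fix r assume "r \<in> tclass p <+>\<^bsub>F\<^esub> tclass q"
    then obtain x y where "x - p \<in> tensor_kernel U V" "y - q \<in> tensor_kernel U V" "r = x + y"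
      by (auto simp: set_add_def' mem_tclass free_space_simps)
    then show "r \<in> tclass (p + q)"
      using kernel_add[of "x - p" "y - q"] by (simp add: mem_tclass algebra_simps)
  next
    fix r assume "r \<in> tclass (p + q)"
    then have "r - q \<in> tclass p" "q \<in> tclass q"
      using kernel_zero by (simp_all add: mem_tclass algebra_simps)
    then show "r \<in> tclass p <+>\<^bsub>F\<^esub> tclass q"
      by (force simp: set_add_def' free_space_simps)
  qed
  then show ?thesis by (simp add: tensor_space_def Let_def tclass_def free_space_simps)
qed

lemma tensor_space_smult: "c \<odot>\<^bsub>T\<^esub> tclass p = tclass (c \<odot>\<^bsub>F\<^esub> p)"
proof -
  have "c \<odot>\<^bsub>T\<^esub> tclass p = (\<Union>q\<in>tclass p. tclass (c \<odot>\<^bsub>F\<^esub> q))"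
    by (simp add: tensor_space_def Let_def tclass_def)
  also have "tclass (c \<odot>\<^bsub>F\<^esub> q) = tclass (c \<odot>\<^bsub>F\<^esub> p)" if "q \<in> tclass p" for q
  proof -
    have "c \<odot>\<^bsub>F\<^esub> (q - p) \<in> tensor_kernel U V" using that by (simp add: mem_tclass)
    also have "c \<odot>\<^bsub>F\<^esub> (q - p) = c \<odot>\<^bsub>F\<^esub> q - c \<odot>\<^bsub>F\<^esub> p"
      by (rule poly_mapping_eqI) (simp add: free_space_simps lookup_scale lookup_minus algebra_simps)
    finally show ?thesis by (simp add: tclass_eq_iff)
  qed
  then have "(\<Union>q\<in>tclass p. tclass (c \<odot>\<^bsub>F\<^esub> q)) = (\<Union>q\<in>tclass p. tclass (c \<odot>\<^bsub>F\<^esub> p))"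
    by (rule SUP_cong[OF refl])
  also have "\<dots> = tclass (c \<odot>\<^bsub>F\<^esub> p)"
    using kernel_zero mem_tclass[of p p] by auto
  finally show ?thesis .
qed

lemma tensor_space_zero: "\<zero>\<^bsub>T\<^esub> = tclass \<zero>\<^bsub>F\<^esub>"
  by (simp add: tensor_space_def Let_def tclass_conv free_space_simps)

sublocale T: Module.module class_ring T
proof (rule module_criteria)
  show "cring (class_ring :: 'k ring)" ..
  have [simp]: "p \<in> carrier F \<Longrightarrow> c \<odot>\<^bsub>F\<^esub> p \<in> carrier F" for c p using F.smult_closed[of c] by simp
  show "\<forall>v\<in>carrier T. \<exists>w\<in>carrier T. v \<oplus>\<^bsub>T\<^esub> w = \<zero>\<^bsub>T\<^esub>"
    by (auto simp: carrier_tensor_space tensor_space_zero tensor_space_add F.r_neg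
      intro!: bexI[of _ "\<ominus>\<^bsub>F\<^esub> _"] )
qed (auto simp: carrier_tensor_space tensor_space_zero tensor_space_add tensor_space_smult
   F.a_ac F.smult_l_distr[simplified] F.smult_r_distr[simplified] F.smult_assoc1[simplified] F.smult_one[simplified]
   intro!: imageI)

lemma tclass_linear: "tclass \<in> linear_maps F T"
  by (rule linear_mapsI) (auto simp: carrier_tensor_space tensor_space_add tensor_space_smult)

lemma pure_tensor_eq: "pure_tensor U V u v = tclass (Poly_Mapping.single (u, v) 1)"
  by (simp add: pure_tensor_def tclass_def)

lemma single_closed: "\<lbrakk>u \<in> carrier U; v \<in> carrier V\<rbrakk> \<Longrightarrow> Poly_Mapping.single (u, v) c \<in> carrier F"
  by (auto simp: free_space_simps)

lemma pure_tensor_closed: "\<lbrakk>u \<in> carrier U; v \<in> carrier V\<rbrakk> \<Longrightarrow> pure_tensor U V u v \<in> carrier T"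
  by (auto simp: pure_tensor_eq carrier_tensor_space intro!: imageI single_closed)

lemma relators_in_kernel:
  assumes "u \<in> carrier U" "v \<in> carrier V"
  shows "u' \<in> carrier U \<Longrightarrow> Poly_Mapping.single (u \<oplus>\<^bsub>U\<^esub> u', v) 1 - (Poly_Mapping.single (u, v) 1
        + Poly_Mapping.single (u', v) 1) \<in> tensor_kernel U V"
    and "v' \<in> carrier V \<Longrightarrow> Poly_Mapping.single (u, v \<oplus>\<^bsub>V\<^esub> v') 1 - (Poly_Mapping.single (u, v) 1
        + Poly_Mapping.single (u, v') 1) \<in> tensor_kernel U V"
    and "Poly_Mapping.single (c \<odot>\<^bsub>U\<^esub> u, v) 1 - Poly_Mapping.single (u, v) c \<in> tensor_kernel U V"
    and "Poly_Mapping.single (u, c \<odot>\<^bsub>V\<^esub> v) 1 - Poly_Mapping.single (u, v) c \<in> tensor_kernel U V"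
proof -
  have mem: "r \<in> tensor_relators U V \<Longrightarrow> r \<in> tensor_kernel U V" for r
    using F.in_own_span[OF relators_subset] unfolding tensor_kernel_def by blast
  show "u' \<in> carrier U \<Longrightarrow> Poly_Mapping.single (u \<oplus>\<^bsub>U\<^esub> u', v) 1 - (Poly_Mapping.single (u, v) 1
        + Poly_Mapping.single (u', v) 1) \<in> tensor_kernel U V"
    unfolding diff_diff_eq[symmetric]
    by (rule mem, unfold tensor_relators_def, rule UnI1, rule UnI1, rule UnI1) (use assms in blast)
  show "v' \<in> carrier V \<Longrightarrow> Poly_Mapping.single (u, v \<oplus>\<^bsub>V\<^esub> v') 1 - (Poly_Mapping.single (u, v) 1
        + Poly_Mapping.single (u, v') 1) \<in> tensor_kernel U V"
    unfolding diff_diff_eq[symmetric]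
    by (rule mem, unfold tensor_relators_def, rule UnI1, rule UnI1, rule UnI2) (use assms in blast)
  show "Poly_Mapping.single (c \<odot>\<^bsub>U\<^esub> u, v) 1 - Poly_Mapping.single (u, v) c \<in> tensor_kernel U V"
    by (rule mem, unfold tensor_relators_def, rule UnI1, rule UnI2) (use assms in blast)
  show "Poly_Mapping.single (u, c \<odot>\<^bsub>V\<^esub> v) 1 - Poly_Mapping.single (u, v) c \<in> tensor_kernel U V"
    by (rule mem, unfold tensor_relators_def, rule UnI2) (use assms in blast)
qed

lemma pure_tensor_bilinear: "bilinear U V T (pure_tensor U V)"
proof (intro bilinearI linear_mapsI)
  fix u v assume uv: "u \<in> carrier U" "v \<in> carrier V"
  show "pure_tensor U V u v \<in> carrier T" by (simp add: uv pure_tensor_closed)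
  then show "pure_tensor U V u v \<in> carrier T" .
  have c: "c \<odot>\<^bsub>F\<^esub> Poly_Mapping.single (u, v) 1 = Poly_Mapping.single (u, v) c" for c
    by (simp add: free_space_simps scale_single)
  show "pure_tensor U V u (c \<odot>\<^bsub>V\<^esub> v) = c \<odot>\<^bsub>T\<^esub> pure_tensor U V u v"
    "pure_tensor U V (c \<odot>\<^bsub>U\<^esub> u) v = c \<odot>\<^bsub>T\<^esub> pure_tensor U V u v" for c
    unfolding pure_tensor_eq tensor_space_smult c tclass_eq_iff
    by (rule relators_in_kernel[OF uv])+
  show "pure_tensor U V u (v \<oplus>\<^bsub>V\<^esub> v') = pure_tensor U V u v \<oplus>\<^bsub>T\<^esub> pure_tensor U V u v'"
    if "v' \<in> carrier V" for v'
    unfolding pure_tensor_eq tensor_space_add tclass_eq_iff free_space_simps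
    by (rule relators_in_kernel(2)[OF uv that])
  show "pure_tensor U V (u \<oplus>\<^bsub>U\<^esub> u') v = pure_tensor U V u v \<oplus>\<^bsub>T\<^esub> pure_tensor U V u' v"
    if "u' \<in> carrier U" for u'
    unfolding pure_tensor_eq tensor_space_add tclass_eq_iff free_space_simps
    by (rule relators_in_kernel(1)[OF uv that])
qed

text \<open>The induction principle for tensor products: linear statements may be checked on pure tensors.\<close>

lemma tensor_submodule_full:
  assumes "submodule class_ring M T"
    and "\<And>u v. \<lbrakk>u \<in> carrier U; v \<in> carrier V\<rbrakk> \<Longrightarrow> pure_tensor U V u v \<in> M"
  shows "M = carrier T"
proof (rule submodule_eqI[OF assms(1)])
  have "{p \<in> carrier F. tclass p \<in> M} = carrier F"
    using linear_maps_preimage_submodule[OF F.module_axioms T.module_axioms tclass_linear assms(1)]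
    by (rule free_space_submodule_full) (auto simp: pure_tensor_eq[symmetric] single_closed assms(2))
  then show "carrier T \<subseteq> M" by (auto simp: carrier_tensor_space)
qed

lemma linear_maps_tensor_eqI:
  assumes "module class_ring W" "f \<in> linear_maps T W" "g \<in> linear_maps T W"
    and "\<And>u v. \<lbrakk>u \<in> carrier U; v \<in> carrier V\<rbrakk> \<Longrightarrow> f (pure_tensor U V u v) = g (pure_tensor U V u v)"
    and "t \<in> carrier T"
  shows "f t = g t"
  using tensor_submodule_full[OF linear_maps_equalizer[OF T.module_axioms assms(1-3)]]
    assms(4,5) pure_tensor_closed by blast

text \<open>Bilinearity says exactly that the linear extension kills the relators.\<close>

lemma linear_extension_kernel:
  assumes "module class_ring W" "bilinear U V W f" "p \<in> tensor_kernel U V"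
  shows "linear_extension W f p = \<zero>\<^bsub>W\<^esub>"
proof -
  interpret W: Module.module class_ring W by fact
  have f: "f u v \<in> carrier W" if "u \<in> carrier U" "v \<in> carrier V" for u v
    by (rule bilinear_closed[OF assms(2) that])
  have lin: "linear_extension W f \<in> linear_maps F W"
    using assms(1) f by (intro linear_extension_linear) auto
  have sub: "submodule class_ring {p \<in> carrier F. linear_extension W f p \<in> {\<zero>\<^bsub>W\<^esub>}} F"
    by (rule linear_maps_preimage_submodule[OF F.module_axioms assms(1) lin])
       (auto intro!: LinearCombinations.submodule.intro assms(1))
  have diff: "linear_extension W f (p - q) = linear_extension W f p \<ominus>\<^bsub>W\<^esub> linear_extension W f q"
    if "p \<in> carrier F" "q \<in> carrier F" for p q
  proof -
    have "p - q = p \<oplus>\<^bsub>F\<^esub> (- 1) \<odot>\<^bsub>F\<^esub> q"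
      by (rule poly_mapping_eqI) (simp add: free_space_simps lookup_scale lookup_add lookup_minus)
    moreover have q': "(- 1) \<odot>\<^bsub>F\<^esub> q \<in> carrier F" using F.smult_closed[of "- 1" q] that by simp
    ultimately show "linear_extension W f (p - q) = linear_extension W f p \<ominus>\<^bsub>W\<^esub> linear_extension W f q"
      using that linear_mapsD(1)[OF lin that(2)] W.smult_minus_1[of "linear_extension W f q"]
      by (simp add: linear_mapsD[OF lin] a_minus_def class_ring_simps)
  qed
  have add: "linear_extension W f (p + q) = linear_extension W f p \<oplus>\<^bsub>W\<^esub> linear_extension W f q"
    and ac: "p + q \<in> carrier F" if "p \<in> carrier F" "q \<in> carrier F" for p q
    using linear_mapsD(2)[OF lin that] F.a_closed[OF that] by (simp_all add: free_space_simps)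
  have 1: "linear_extension W f (Poly_Mapping.single (u, v) c) = c \<odot>\<^bsub>W\<^esub> f u v"
    if "u \<in> carrier U" "v \<in> carrier V" for u v c
    using that by (intro linear_extension_single assms(1) f)
  have s: "c \<odot>\<^bsub>W\<^esub> w \<in> carrier W" if "w \<in> carrier W" for c w using W.smult_closed[of c] that by simp
  have "linear_extension W f r = \<zero>\<^bsub>W\<^esub>" if "r \<in> tensor_relators U V" for r
    using that U.smult_closed[simplified] V.smult_closed[simplified] f s
    unfolding tensor_relators_def
    by (auto simp: diff_diff_eq add ac diff single_closed 1 W.smult_one[simplified] linear_mapsD[OF bilinearD(1)[OF assms(2)]]
        linear_mapsD[OF bilinearD(2)[OF assms(2)]] a_minus_def W.r_neg)
  then have "tensor_kernel U V \<subseteq> {p \<in> carrier F. linear_extension W f p \<in> {\<zero>\<^bsub>W\<^esub>}}"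
    unfolding tensor_kernel_def using relators_subset by (intro F.span_is_subset[OF _ sub]) auto
  then show ?thesis using assms(3) by auto
qed

text \<open>By the preceding lemma the linear extension is constant on cosets, so that \<open>the_elem\<close> in the
  definition of \<open>tensor_lift\<close> is applied to a singleton.\<close>

lemma tensor_lift_tclass:
  assumes "module class_ring W" "bilinear U V W f" "p \<in> carrier F"
  shows "tensor_lift W f (tclass p) = linear_extension W f p"
proof -
  interpret W: Module.module class_ring W by fact
  have lin: "linear_extension W f \<in> linear_maps F W"
    using assms(1) bilinear_closed[OF assms(2)] by (intro linear_extension_linear) auto
  have "linear_extension W f q = linear_extension W f p" if "q \<in> tclass p" for q
  proof -
    from that obtain n where n: "n \<in> tensor_kernel U V" "q = n \<oplus>\<^bsub>F\<^esub> p"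
      by (auto simp: tclass_conv free_space_simps)
    have "n \<in> carrier F" using n(1) N.subset by blast
    with n assms(3) show ?thesis
      by (simp add: linear_mapsD[OF lin] linear_extension_kernel[OF assms(1,2)])
  qed
  moreover have "p \<in> tclass p" using kernel_zero by (simp add: mem_tclass)
  ultimately have "linear_extension W f ` tclass p = {linear_extension W f p}" by blast
  then show ?thesis by (simp add: tensor_lift_eq)
qed

lemma tensor_lift_linear:
  assumes "module class_ring W" "bilinear U V W f"
  shows "tensor_lift W f \<in> linear_maps T W"
proof -
  have lin: "linear_extension W f \<in> linear_maps F W"
    using assms(1) bilinear_closed[OF assms(2)] by (intro linear_extension_linear) auto
  show ?thesis
    by (rule linear_mapsI)
      (auto simp: carrier_tensor_space tensor_space_add tensor_space_smult tensor_lift_tclass[OF assms]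
        linear_mapsD[OF lin] F.smult_closed[simplified])
qed

lemma tensor_lift_pure:
  assumes "module class_ring W" "bilinear U V W f" "u \<in> carrier U" "v \<in> carrier V"
  shows "tensor_lift W f (pure_tensor U V u v) = f u v"
proof -
  interpret W: Module.module class_ring W by fact
  show ?thesis
    using bilinear_closed[OF assms(2-4)] assms(3,4)
    by (simp add: pure_tensor_eq tensor_lift_tclass[OF assms(1,2)] single_closed
        linear_extension_single[of W f u v, OF assms(1)] W.smult_one[simplified])
qed

text \<open>Both sides are linear in the tensor and agree on pure tensors.\<close>

lemma linear_map_tensor_lift:
  assumes "module class_ring W" "module class_ring X" "bilinear U V W f" "g \<in> linear_maps W X"
    and "t \<in> carrier T"
  shows "g (tensor_lift W f t) = tensor_lift X (\<lambda>u v. g (f u v)) t"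
proof (rule linear_maps_tensor_eqI[OF assms(2) _ _ _ assms(5)])
  have gf: "bilinear U V X (\<lambda>u v. g (f u v))" by (rule bilinear_comp[OF assms(3,4)])
  show "(\<lambda>t. g (tensor_lift W f t)) \<in> linear_maps T X"
    by (rule linear_maps_comp[OF tensor_lift_linear[OF assms(1,3)] assms(4)])
  show "tensor_lift X (\<lambda>u v. g (f u v)) \<in> linear_maps T X"
    by (rule tensor_lift_linear[OF assms(2) gf])
  fix u v assume "u \<in> carrier U" "v \<in> carrier V"
  then show "g (tensor_lift W f (pure_tensor U V u v)) = tensor_lift X (\<lambda>u v. g (f u v)) (pure_tensor U V u v)"
    using assms gf by (simp add: tensor_lift_pure)
qed

lemma tensor_lift_cong:
  assumes "module class_ring W" "bilinear U V W f" "bilinear U V W g"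
    and "\<And>u v. \<lbrakk>u \<in> carrier U; v \<in> carrier V\<rbrakk> \<Longrightarrow> f u v = g u v" "t \<in> carrier T"
  shows "tensor_lift W f t = tensor_lift W g t"
  by (rule linear_maps_tensor_eqI[OF assms(1) tensor_lift_linear[OF assms(1,2)] tensor_lift_linear[OF assms(1,3)] _ assms(5)])
    (simp add: tensor_lift_pure[OF assms(1)] assms)

text \<open>This is what makes nested lifts, and hence iterated Sweedler sums, multilinear.\<close>

lemma tensor_lift_linear_param:
  assumes "module class_ring W" "module class_ring X" "t \<in> carrier T"
    and f: "\<And>x. x \<in> carrier X \<Longrightarrow> bilinear U V W (f x)"
    and lin: "\<And>u v. \<lbrakk>u \<in> carrier U; v \<in> carrier V\<rbrakk> \<Longrightarrow> (\<lambda>x. f x u v) \<in> linear_maps X W"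
  shows "(\<lambda>x. tensor_lift W (f x) t) \<in> linear_maps X W"
proof -
  interpret W: Module.module class_ring W by fact
  interpret X: Module.module class_ring X by fact
  note L = tensor_lift_linear[OF assms(1) f]
  note sc = W.smult_closed[simplified] X.smult_closed[simplified]
  show ?thesis
  proof (rule linear_mapsI)
    fix x y c assume x: "x \<in> carrier X"
    show "tensor_lift W (f x) t \<in> carrier W" by (rule linear_mapsD(1)[OF L[OF x] assms(3)])
    have cx: "c \<odot>\<^bsub>X\<^esub> x \<in> carrier X" using x sc by blast
    show "tensor_lift W (f (c \<odot>\<^bsub>X\<^esub> x)) t = c \<odot>\<^bsub>W\<^esub> tensor_lift W (f x) t"
    proof (rule linear_maps_tensor_eqI[OF assms(1) L[OF cx] _ _ assms(3)])
      show "(\<lambda>t. c \<odot>\<^bsub>W\<^esub> tensor_lift W (f x) t) \<in> linear_maps T W"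
        using linear_mapsD[OF L[OF x]] W.smult_r_distr[simplified] W.smult_assoc1[simplified] sc
        by (intro linear_mapsI) (auto simp: mult.commute simp flip: W.smult_assoc1[simplified])
    qed (use x cx in \<open>simp add: tensor_lift_pure[OF assms(1) f] linear_mapsD(3)[OF lin]\<close>)
    assume y: "y \<in> carrier X"
    have xy: "x \<oplus>\<^bsub>X\<^esub> y \<in> carrier X" using x y by simp
    show "tensor_lift W (f (x \<oplus>\<^bsub>X\<^esub> y)) t = tensor_lift W (f x) t \<oplus>\<^bsub>W\<^esub> tensor_lift W (f y) t"
    proof (rule linear_maps_tensor_eqI[OF assms(1) L[OF xy] _ _ assms(3)])
      show "(\<lambda>t. tensor_lift W (f x) t \<oplus>\<^bsub>W\<^esub> tensor_lift W (f y) t) \<in> linear_maps T W"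
        using linear_mapsD[OF L[OF x]] linear_mapsD[OF L[OF y]] W.smult_r_distr[simplified]
        by (intro linear_mapsI) (auto simp: W.a_ac)
    qed (use x y xy in \<open>simp add: tensor_lift_pure[OF assms(1) f] linear_mapsD(2)[OF lin]\<close>)
  qed
qed

end

section \<open>Functionals\<close>

lemma field_algebra_simps [simp]:
  "carrier field_algebra = UNIV" "\<zero>\<^bsub>field_algebra\<^esub> = 0" "\<one>\<^bsub>field_algebra\<^esub> = 1"
  "x \<oplus>\<^bsub>field_algebra\<^esub> y = x + y" "x \<otimes>\<^bsub>field_algebra\<^esub> y = x * y" "c \<odot>\<^bsub>field_algebra\<^esub> x = c * x"
  by (simp_all add: field_algebra_def)

lemma module_field_algebra: "module class_ring (field_algebra :: ('k::field, 'k) module)"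
proof (rule module_criteria)
  show "cring (class_ring :: 'k ring)" ..
  show "\<forall>v\<in>carrier field_algebra. \<exists>w\<in>carrier field_algebra. v \<oplus>\<^bsub>field_algebra\<^esub> w = \<zero>\<^bsub>field_algebra :: ('k, 'k) module\<^esub>"
    by (auto intro!: exI[of _ "- _"])
qed (auto simp: algebra_simps)

abbreviation functionals where
  "functionals U \<equiv> linear_maps U field_algebra"

lemma linear_maps_id: "(\<lambda>x. x) \<in> linear_maps U U"
  by (rule linear_mapsI) simp_all

lemma functional_mult_left: "\<phi> \<in> functionals U \<Longrightarrow> (\<lambda>x. a * \<phi> x) \<in> functionals U"
  by (rule linear_mapsI) (simp_all add: linear_mapsD algebra_simps)

lemma functional_mult_right: "\<phi> \<in> functionals U \<Longrightarrow> (\<lambda>x. \<phi> x * a) \<in> functionals U"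
  by (rule linear_mapsI) (simp_all add: linear_mapsD algebra_simps)

lemma functional_add: "\<lbrakk>\<phi> \<in> functionals U; \<psi> \<in> functionals U\<rbrakk> \<Longrightarrow> (\<lambda>x. \<phi> x + \<psi> x) \<in> functionals U"
  by (rule linear_mapsI) (simp_all add: linear_mapsD algebra_simps)

lemma functional_zero: "(\<lambda>x. 0) \<in> functionals U"
  by (rule linear_mapsI) simp_all

lemma functional_sum: "(\<And>i. i \<in> I \<Longrightarrow> \<phi> i \<in> functionals U) \<Longrightarrow> (\<lambda>x. \<Sum>i\<in>I. \<phi> i x) \<in> functionals U"
  by (induction I rule: infinite_finite_induct) (simp_all add: functional_zero functional_add)

context tensor_factors
begin

lemma tensor_lift_form_sum:
  assumes "\<And>i. i \<in> I \<Longrightarrow> bilinear U V field_algebra (f i)" "t \<in> carrier T"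
  shows "tensor_lift field_algebra (\<lambda>u v. \<Sum>i\<in>I. f i u v) t = (\<Sum>i\<in>I. tensor_lift field_algebra (f i) t)"
proof (rule linear_maps_tensor_eqI[OF module_field_algebra _ _ _ assms(2)])
  have b: "bilinear U V field_algebra (\<lambda>u v. \<Sum>i\<in>I. f i u v)"
    by (intro bilinearI functional_sum bilinearD[OF assms(1)])
  note lift = tensor_lift_pure[OF module_field_algebra] tensor_lift_linear[OF module_field_algebra]
  show "tensor_lift field_algebra (\<lambda>u v. \<Sum>i\<in>I. f i u v) \<in> functionals T"
    by (rule lift(2)[OF b])
  show "(\<lambda>t. \<Sum>i\<in>I. tensor_lift field_algebra (f i) t) \<in> functionals T"
    by (intro functional_sum lift(2) assms(1))
  show "tensor_lift field_algebra (\<lambda>u v. \<Sum>i\<in>I. f i u v) (pure_tensor U V u v)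
      = (\<Sum>i\<in>I. tensor_lift field_algebra (f i) (pure_tensor U V u v))"
    if "u \<in> carrier U" "v \<in> carrier V" for u v
    using that by (simp add: lift(1)[OF b] lift(1)[OF assms(1)])
qed

lemma tensor_lift_form_scale:
  assumes "bilinear U V field_algebra f" "t \<in> carrier T"
  shows "tensor_lift field_algebra (\<lambda>u v. a * f u v) t = a * tensor_lift field_algebra f t"
  using linear_map_tensor_lift[OF module_field_algebra module_field_algebra assms(1)
    functional_mult_left[OF linear_maps_id] assms(2), of a] by simp

end

text \<open>Both sides are linear in \<open>t\<close>, and for a pure tensor \<open>t\<close> the inner lifts can be evaluated.\<close>

lemma tensor_lift_fubini:
  fixes U :: "('k::field, 'u, 'm) module_scheme"
  assumes UV: "tensor_factors U V" and XY: "tensor_factors X Y"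
    and s: "s \<in> carrier (tensor_space U V)" and t: "t \<in> carrier (tensor_space X Y)"
    and uv: "\<And>x y. \<lbrakk>x \<in> carrier X; y \<in> carrier Y\<rbrakk> \<Longrightarrow> bilinear U V field_algebra (\<lambda>u v. F u v x y)"
    and xy: "\<And>u v. \<lbrakk>u \<in> carrier U; v \<in> carrier V\<rbrakk> \<Longrightarrow> bilinear X Y field_algebra (F u v)"
  shows "tensor_lift field_algebra (\<lambda>u v. tensor_lift field_algebra (F u v) t) s
    = tensor_lift field_algebra (\<lambda>x y. tensor_lift field_algebra (\<lambda>u v. F u v x y) s) t"
proof -
  interpret UV: tensor_factors U V by fact
  interpret XY: tensor_factors X Y by fact
  note K = module_field_algebra
  have 1: "bilinear U V field_algebra (\<lambda>u v. tensor_lift field_algebra (F u v) t)"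
    if "t \<in> carrier (tensor_space X Y)" for t
    by (intro bilinearI XY.tensor_lift_linear_param[OF K _ that] UV.U.module_axioms UV.V.module_axioms xy
        bilinearD[OF uv])
  have 2: "bilinear X Y field_algebra (\<lambda>x y. tensor_lift field_algebra (\<lambda>u v. F u v x y) s)"
    by (intro bilinearI UV.tensor_lift_linear_param[OF K _ s] XY.U.module_axioms XY.V.module_axioms uv
        bilinearD[OF xy])
  show ?thesis
  proof (rule XY.linear_maps_tensor_eqI[OF K _ _ _ t])
    show "(\<lambda>t. tensor_lift field_algebra (\<lambda>u v. tensor_lift field_algebra (F u v) t) s) \<in> functionals (tensor_space X Y)"
      by (intro UV.tensor_lift_linear_param[OF K _ s] XY.T.module_axioms 1 XY.tensor_lift_linear[OF K] xy)
    show "tensor_lift field_algebra (\<lambda>x y. tensor_lift field_algebra (\<lambda>u v. F u v x y) s) \<in> functionals (tensor_space X Y)"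
      by (rule XY.tensor_lift_linear[OF K 2])
    fix x y assume x: "x \<in> carrier X" "y \<in> carrier Y"
    have "tensor_lift field_algebra (\<lambda>u v. tensor_lift field_algebra (F u v) (pure_tensor X Y x y)) s
      = tensor_lift field_algebra (\<lambda>u v. F u v x y) s"
      by (rule UV.tensor_lift_cong[OF K 1 uv _ s])
        (simp_all add: x XY.pure_tensor_closed XY.tensor_lift_pure[OF K xy])
    then show "tensor_lift field_algebra (\<lambda>u v. tensor_lift field_algebra (F u v) (pure_tensor X Y x y)) s
      = tensor_lift field_algebra (\<lambda>x y. tensor_lift field_algebra (\<lambda>u v. F u v x y) s) (pure_tensor X Y x y)"
      by (simp add: XY.tensor_lift_pure[OF K 2 x])
  qed
qed

section \<open>Sweedler calculus on scalar-valued forms\<close>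

context hopf_algebra
begin

sublocale LL: tensor_factors L L
  by (rule tensor_factors.intro) (rule module_axioms)+

abbreviation "bilinear_form \<equiv> bilinear L L (field_algebra :: ('k, 'k) module)"

text \<open>The sum \<open>F h\<^sub>1 h\<^sub>2\<close> of Sweedler notation.  Scalar values are enough: an identity between
  elements is used only through its images under functionals.\<close>

definition sweedler :: "('a \<Rightarrow> 'a \<Rightarrow> 'k) \<Rightarrow> 'a \<Rightarrow> 'k" where
  "sweedler F h = tensor_lift field_algebra F (comult L h)"

lemma smult_carrier [simp]: "x \<in> carrier L \<Longrightarrow> c \<odot> x \<in> carrier L"
  using smult_closed[of c] by simp

lemma comult_closed: "h \<in> carrier L \<Longrightarrow> comult L h \<in> carrier (tensor_space L L)"
  by (rule linear_mapsD(1)[OF comult_linear])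

lemma antipode_closed [simp]: "h \<in> carrier L \<Longrightarrow> antipode L h \<in> carrier L"
  by (rule linear_mapsD(1)[OF antipode_linear])

lemma counit_mult: "\<lbrakk>x \<in> carrier L; y \<in> carrier L\<rbrakk> \<Longrightarrow> counit L (x \<otimes> y) = counit L x * counit L y"
  using counit_hom by (simp add: Ring.ring_hom_def)

lemma linear_maps_mult_left: "\<lbrakk>f \<in> linear_maps U L; a \<in> carrier L\<rbrakk> \<Longrightarrow> (\<lambda>x. a \<otimes> f x) \<in> linear_maps U L"
  by (rule linear_mapsI) (simp_all add: linear_mapsD r_distr smult_mult_right)

lemma linear_maps_mult_right: "\<lbrakk>f \<in> linear_maps U L; a \<in> carrier L\<rbrakk> \<Longrightarrow> (\<lambda>x. f x \<otimes> a) \<in> linear_maps U L"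
  by (rule linear_mapsI) (simp_all add: linear_mapsD l_distr smult_mult_left)

lemmas linear_maps_counit = linear_maps_comp[OF _ counit_linear]
lemmas linear_maps_antipode = linear_maps_comp[OF _ antipode_linear]

lemmas linear_intros = linear_maps_id functional_mult_left functional_mult_right
  linear_maps_mult_left linear_maps_mult_right linear_maps_counit linear_maps_antipode

lemma sweedler_linear: "bilinear_form F \<Longrightarrow> sweedler F \<in> functionals L"
  unfolding sweedler_def[abs_def]
  by (rule linear_maps_comp[OF comult_linear LL.tensor_lift_linear[OF module_field_algebra]])

lemma sweedler_linear_param:
  assumes "module class_ring X" "h \<in> carrier L" "\<And>x. x \<in> carrier X \<Longrightarrow> bilinear_form (F x)"
    and "\<And>u v. \<lbrakk>u \<in> carrier L; v \<in> carrier L\<rbrakk> \<Longrightarrow> (\<lambda>x. F x u v) \<in> functionals X"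
  shows "(\<lambda>x. sweedler (F x) h) \<in> functionals X"
  unfolding sweedler_def
  by (rule LL.tensor_lift_linear_param[OF module_field_algebra assms(1) comult_closed[OF assms(2)] assms(3,4)])

lemma sweedler_cong:
  assumes "bilinear_form F" "h \<in> carrier L"
    and "\<And>x y. \<lbrakk>x \<in> carrier L; y \<in> carrier L\<rbrakk> \<Longrightarrow> F x y = G x y"
  shows "sweedler F h = sweedler G h"
proof -
  have "bilinear_form G"
  proof (rule bilinearI)
    fix x assume x: "x \<in> carrier L"
    show "G x \<in> functionals L" "(\<lambda>y. G y x) \<in> functionals L"
      by (rule linear_maps_cong[OF bilinearD(1)[OF assms(1) x]]
          linear_maps_cong[OF bilinearD(2)[OF assms(1) x]], simp add: assms(3) x, rule module_axioms)+
  qed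
  then show ?thesis
    unfolding sweedler_def
    by (intro LL.tensor_lift_cong[OF module_field_algebra assms(1)] assms(3) comult_closed assms(2))
qed

lemma sweedler_sum:
  "\<lbrakk>\<And>i. i \<in> I \<Longrightarrow> bilinear_form (F i); h \<in> carrier L\<rbrakk> \<Longrightarrow>
    sweedler (\<lambda>x y. \<Sum>i\<in>I. F i x y) h = (\<Sum>i\<in>I. sweedler (F i) h)"
  unfolding sweedler_def by (rule LL.tensor_lift_form_sum[OF _ comult_closed])

lemma sweedler_scale:
  "\<lbrakk>bilinear_form F; h \<in> carrier L\<rbrakk> \<Longrightarrow> sweedler (\<lambda>x y. a * F x y) h = a * sweedler F h"
  unfolding sweedler_def by (rule LL.tensor_lift_form_scale[OF _ comult_closed])

text \<open>This is the bridge from the vector-valued axioms to scalar-valued forms.\<close>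

lemma functional_tensor_lift:
  assumes "module class_ring W" "bilinear L L W f" "\<phi> \<in> functionals W" "h \<in> carrier L"
  shows "\<phi> (tensor_lift W f (comult L h)) = sweedler (\<lambda>x y. \<phi> (f x y)) h"
  unfolding sweedler_def
  by (rule LL.linear_map_tensor_lift[OF assms(1) module_field_algebra assms(2,3) comult_closed[OF assms(4)]])

lemma smult_linear_left: "\<phi> \<in> functionals U \<Longrightarrow> a \<in> carrier L \<Longrightarrow> (\<lambda>x. \<phi> x \<odot> a) \<in> linear_maps U L"
  by (rule linear_mapsI) (simp_all add: linear_mapsD smult_l_distr[simplified] smult_assoc1[simplified])

lemma smult_linear_right: "f \<in> linear_maps U L \<Longrightarrow> (\<lambda>x. c \<odot> f x) \<in> linear_maps U L"
  by (rule linear_mapsI) (simp_all add: linear_mapsD smult_r_distr[simplified] mult.commute flip: smult_assoc1[simplified])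

lemma sweedler_counit_left:
  assumes "\<phi> \<in> functionals L" "h \<in> carrier L"
  shows "sweedler (\<lambda>x y. counit L x * \<phi> y) h = \<phi> h"
proof -
  have b: "bilinear L L L (\<lambda>x y. counit L x \<odot> y)"
    by (intro bilinearI smult_linear_left smult_linear_right counit_linear linear_maps_id)
  have "\<phi> h = sweedler (\<lambda>x y. \<phi> (counit L x \<odot> y)) h"
    using functional_tensor_lift[OF module_axioms b assms] counit_left[OF assms(2)] by simp
  also have "\<dots> = sweedler (\<lambda>x y. counit L x * \<phi> y) h"
    by (rule sweedler_cong[OF bilinear_comp[OF b assms(1)] assms(2)]) (simp add: linear_mapsD[OF assms(1)])
  finally show ?thesis by simp
qed

lemma sweedler_counit_right:
  assumes "\<phi> \<in> functionals L" "h \<in> carrier L"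
  shows "sweedler (\<lambda>x y. \<phi> x * counit L y) h = \<phi> h"
proof -
  have b: "bilinear L L L (\<lambda>x y. counit L y \<odot> x)"
    by (intro bilinearI smult_linear_left smult_linear_right counit_linear linear_maps_id)
  have "\<phi> h = sweedler (\<lambda>x y. \<phi> (counit L y \<odot> x)) h"
    using functional_tensor_lift[OF module_axioms b assms] counit_right[OF assms(2)] by simp
  also have "\<dots> = sweedler (\<lambda>x y. \<phi> x * counit L y) h"
    by (rule sweedler_cong[OF bilinear_comp[OF b assms(1)] assms(2)]) (simp add: linear_mapsD[OF assms(1)])
  finally show ?thesis by simp
qed

lemma sweedler_antipode_left:
  assumes "\<phi> \<in> functionals L" "h \<in> carrier L"
  shows "sweedler (\<lambda>x y. \<phi> (antipode L x \<otimes> y)) h = counit L h * \<phi> \<one>"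
proof -
  have b: "bilinear L L L (\<lambda>x y. antipode L x \<otimes> y)"
    by (intro bilinearI linear_intros antipode_closed)
  show ?thesis
    using functional_tensor_lift[OF module_axioms b assms] antipode_left[OF assms(2)]
      linear_mapsD(3)[OF assms(1) one_closed] by simp
qed

text \<open>Trilinear forms are the forms on which both sides of coassociativity can be evaluated.\<close>

definition trilinear_form :: "('a \<Rightarrow> 'a \<Rightarrow> 'a \<Rightarrow> 'k) \<Rightarrow> bool" where
  "trilinear_form F \<longleftrightarrow> (\<forall>x\<in>carrier L. bilinear_form (F x)) \<and>
     (\<forall>y\<in>carrier L. \<forall>z\<in>carrier L. (\<lambda>x. F x y z) \<in> functionals L)"

lemma trilinear_formI:
  assumes "\<And>y z. \<lbrakk>y \<in> carrier L; z \<in> carrier L\<rbrakk> \<Longrightarrow> (\<lambda>x. F x y z) \<in> functionals L"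
    and "\<And>x z. \<lbrakk>x \<in> carrier L; z \<in> carrier L\<rbrakk> \<Longrightarrow> (\<lambda>y. F x y z) \<in> functionals L"
    and "\<And>x y. \<lbrakk>x \<in> carrier L; y \<in> carrier L\<rbrakk> \<Longrightarrow> F x y \<in> functionals L"
  shows "trilinear_form F"
  using assms by (simp add: trilinear_form_def bilinear_def)

lemma trilinear_formD:
  assumes "trilinear_form F"
  shows "x \<in> carrier L \<Longrightarrow> bilinear_form (F x)"
    and "y \<in> carrier L \<Longrightarrow> bilinear_form (\<lambda>x z. F x y z)"
    and "z \<in> carrier L \<Longrightarrow> bilinear_form (\<lambda>x y. F x y z)"
  using assms by (auto simp: trilinear_form_def bilinear_def)

text \<open>A trilinear form induces a functional \<open>\<Phi>\<close> on \<open>L \<otimes> (L \<otimes> L)\<close>; the claim is the coassociativity axiom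
  under \<open>\<Phi>\<close>.\<close>

lemma sweedler_coassoc:
  assumes "trilinear_form F" "h \<in> carrier L"
  shows "sweedler (\<lambda>x z. sweedler (\<lambda>x1 x2. F x1 x2 z) x) h = sweedler (\<lambda>x z. sweedler (F x) z) h"
proof -
  note K = module_field_algebra
  note F = trilinear_formD[OF assms(1)]
  let ?T2 = "tensor_space L L" and ?T3 = "tensor_space L (tensor_space L L)"
  interpret T3: tensor_factors L ?T2
    by (rule tensor_factors.intro) (rule module_axioms LL.T.module_axioms)+
  define \<Phi> where "\<Phi> = tensor_lift field_algebra (\<lambda>x w. tensor_lift field_algebra (F x) w)"
  have bF: "bilinear L ?T2 field_algebra (\<lambda>x w. tensor_lift field_algebra (F x) w)"
    by (intro bilinearI LL.tensor_lift_linear[OF K] F(1) LL.tensor_lift_linear_param[OF K module_axioms]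
        bilinearD[OF F(2)])
  have \<Phi>: "\<Phi> \<in> functionals ?T3"
    unfolding \<Phi>_def by (rule T3.tensor_lift_linear[OF K bF])
  have \<Phi>p: "\<Phi> (pure_tensor L ?T2 x w) = tensor_lift field_algebra (F x) w"
    if "x \<in> carrier L" "w \<in> carrier ?T2" for x w
    unfolding \<Phi>_def by (rule T3.tensor_lift_pure[OF K bF that])
  have b1: "bilinear L L ?T3 (\<lambda>x1 x2. pure_tensor L ?T2 x1 (pure_tensor L L x2 y))" if "y \<in> carrier L" for y
    using that LL.pure_tensor_closed
    by (intro bilinearI bilinearD(2)[OF T3.pure_tensor_bilinear]
      linear_maps_comp[OF bilinearD(2)[OF LL.pure_tensor_bilinear] bilinearD(1)[OF T3.pure_tensor_bilinear]]) auto
  have b1': "(\<lambda>y. pure_tensor L ?T2 x1 (pure_tensor L L x2 y)) \<in> linear_maps L ?T3"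
    if "x1 \<in> carrier L" "x2 \<in> carrier L" for x1 x2
    by (rule linear_maps_comp[OF bilinearD(1)[OF LL.pure_tensor_bilinear that(2)] bilinearD(1)[OF T3.pure_tensor_bilinear that(1)]])
  have b2: "bilinear L L ?T3 (\<lambda>x y. tensor_lift ?T3
           (\<lambda>x1 x2. pure_tensor L ?T2 x1 (pure_tensor L L x2 y)) (comult L x))"
    by (intro bilinearI LL.tensor_lift_linear_param[OF T3.T.module_axioms module_axioms comult_closed] b1 b1'
       linear_maps_comp[OF comult_linear LL.tensor_lift_linear[OF T3.T.module_axioms]])
  have b3: "bilinear L L ?T3 (\<lambda>x y. pure_tensor L ?T2 x (comult L y))"
    by (intro bilinearI linear_maps_comp[OF comult_linear] bilinearD[OF T3.pure_tensor_bilinear] comult_closed)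
  have "sweedler (\<lambda>x z. sweedler (\<lambda>x1 x2. F x1 x2 z) x) h
    = sweedler (\<lambda>x z. \<Phi> (tensor_lift ?T3 (\<lambda>x1 x2. pure_tensor L ?T2 x1 (pure_tensor L L x2 z)) (comult L x))) h"
  proof (rule sweedler_cong[OF _ assms(2), symmetric])
    show "bilinear_form (\<lambda>x z. \<Phi> (tensor_lift ?T3 (\<lambda>x1 x2. pure_tensor L ?T2 x1 (pure_tensor L L x2 z)) (comult L x)))"
      by (rule bilinear_comp[OF b2 \<Phi>])
    fix x z assume x: "x \<in> carrier L" and z: "z \<in> carrier L"
    have "\<Phi> (tensor_lift ?T3 (\<lambda>x1 x2. pure_tensor L ?T2 x1 (pure_tensor L L x2 z)) (comult L x))
       = sweedler (\<lambda>x1 x2. \<Phi> (pure_tensor L ?T2 x1 (pure_tensor L L x2 z))) x"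
      by (rule functional_tensor_lift[OF T3.T.module_axioms b1[OF z] \<Phi> x])
    also have "\<dots> = sweedler (\<lambda>x1 x2. F x1 x2 z) x"
      by (rule sweedler_cong[OF bilinear_comp[OF b1[OF z] \<Phi>] x])
        (simp add: \<Phi>p LL.pure_tensor_closed z LL.tensor_lift_pure[OF K F(1)])
    finally show "\<Phi> (tensor_lift ?T3 (\<lambda>x1 x2. pure_tensor L ?T2 x1 (pure_tensor L L x2 z)) (comult L x))
       = sweedler (\<lambda>x1 x2. F x1 x2 z) x" .
  qed
  also have "\<dots> = \<Phi> (tensor_lift ?T3 (\<lambda>x z. tensor_lift ?T3 (\<lambda>x1 x2. pure_tensor L ?T2 x1 (pure_tensor L L x2 z)) (comult L x)) (comult L h))"
    by (rule functional_tensor_lift[OF T3.T.module_axioms b2 \<Phi> assms(2), symmetric])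
  also have "\<dots> = \<Phi> (tensor_lift ?T3 (\<lambda>x y. pure_tensor L ?T2 x (comult L y)) (comult L h))"
    using coassoc[OF assms(2)] by simp
  also have "\<dots> = sweedler (\<lambda>x y. \<Phi> (pure_tensor L ?T2 x (comult L y))) h"
    by (rule functional_tensor_lift[OF T3.T.module_axioms b3 \<Phi> assms(2)])
  also have "\<dots> = sweedler (\<lambda>x z. sweedler (F x) z) h"
    by (rule sweedler_cong[OF bilinear_comp[OF b3 \<Phi>] assms(2)])
      (simp add: \<Phi>p comult_closed sweedler_def)
  finally show ?thesis .
qed

text \<open>The comultiplication is multiplicative: apply the functional induced by \<open>F\<close> to
  \<open>\<Delta> (h g) = \<Delta> h \<Delta> g\<close>.\<close>

lemma sweedler_mult:
  assumes "bilinear_form F" "h \<in> carrier L" "g \<in> carrier L"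
  shows "sweedler F (h \<otimes> g) = sweedler (\<lambda>a b. sweedler (\<lambda>a' b'. F (a \<otimes> a') (b \<otimes> b')) g) h"
proof -
  note K = module_field_algebra and T = LL.T.module_axioms
  define \<Phi> where "\<Phi> = tensor_lift field_algebra F"
  have \<Phi>: "\<Phi> \<in> functionals (tensor_space L L)"
    unfolding \<Phi>_def by (rule LL.tensor_lift_linear[OF K assms(1)])
  have \<Phi>p: "\<Phi> (pure_tensor L L x y) = F x y" if "x \<in> carrier L" "y \<in> carrier L" for x y
    unfolding \<Phi>_def by (rule LL.tensor_lift_pure[OF K assms(1) that])
  note pl = linear_maps_comp[OF _ bilinearD(1)[OF LL.pure_tensor_bilinear]]
    linear_maps_comp[OF _ bilinearD(2)[OF LL.pure_tensor_bilinear]]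
  have b1: "bilinear L L (tensor_space L L) (\<lambda>a' b'. pure_tensor L L (a \<otimes> a') (b \<otimes> b'))"
    if "a \<in> carrier L" "b \<in> carrier L" for a b
    using that by (intro bilinearI pl linear_intros) auto
  have b2: "bilinear L L (tensor_space L L) (\<lambda>a b. tensor_lift (tensor_space L L)
       (\<lambda>a' b'. pure_tensor L L (a \<otimes> a') (b \<otimes> b')) (comult L g))"
    using assms(3) by (intro bilinearI LL.tensor_lift_linear_param[OF T module_axioms comult_closed] b1 pl linear_intros) auto
  have "comult L (h \<otimes> g) = comult L h \<otimes>\<^bsub>tensor_algebra L L\<^esub> comult L g"
    using comult_hom assms by (simp add: Ring.ring_hom_def)
  then have "sweedler F (h \<otimes> g) = \<Phi> (tensor_lift (tensor_space L L) (\<lambda>a b. tensor_lift (tensor_space L L)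
       (\<lambda>a' b'. pure_tensor L L (a \<otimes> a') (b \<otimes> b')) (comult L g)) (comult L h))"
    by (simp add: sweedler_def \<Phi>_def tensor_algebra_def Let_def)
  also have "\<dots> = sweedler (\<lambda>a b. \<Phi> (tensor_lift (tensor_space L L)
       (\<lambda>a' b'. pure_tensor L L (a \<otimes> a') (b \<otimes> b')) (comult L g))) h"
    by (rule functional_tensor_lift[OF T b2 \<Phi> assms(2)])
  also have "\<dots> = sweedler (\<lambda>a b. sweedler (\<lambda>a' b'. F (a \<otimes> a') (b \<otimes> b')) g) h"
  proof (rule sweedler_cong[OF bilinear_comp[OF b2 \<Phi>] assms(2)])
    fix a b assume ab: "a \<in> carrier L" "b \<in> carrier L"
    have "\<Phi> (tensor_lift (tensor_space L L) (\<lambda>a' b'. pure_tensor L L (a \<otimes> a') (b \<otimes> b')) (comult L g))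
       = sweedler (\<lambda>a' b'. \<Phi> (pure_tensor L L (a \<otimes> a') (b \<otimes> b'))) g"
      by (rule functional_tensor_lift[OF T b1[OF ab] \<Phi> assms(3)])
    also have "\<dots> = sweedler (\<lambda>a' b'. F (a \<otimes> a') (b \<otimes> b')) g"
      by (rule sweedler_cong[OF bilinear_comp[OF b1[OF ab] \<Phi>] assms(3)]) (simp add: \<Phi>p ab)
    finally show "\<Phi> (tensor_lift (tensor_space L L) (\<lambda>a' b'. pure_tensor L L (a \<otimes> a') (b \<otimes> b')) (comult L g))
      = sweedler (\<lambda>a' b'. F (a \<otimes> a') (b \<otimes> b')) g" .
  qed
  finally show ?thesis .
qed

lemma sweedler_swap:
  assumes "h \<in> carrier L" "g \<in> carrier L"
    and "\<And>c d. \<lbrakk>c \<in> carrier L; d \<in> carrier L\<rbrakk> \<Longrightarrow> bilinear_form (\<lambda>a b. F a b c d)"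
    and "\<And>a b. \<lbrakk>a \<in> carrier L; b \<in> carrier L\<rbrakk> \<Longrightarrow> bilinear_form (F a b)"
  shows "sweedler (\<lambda>a b. sweedler (F a b) g) h = sweedler (\<lambda>c d. sweedler (\<lambda>a b. F a b c d) h) g"
  unfolding sweedler_def
  by (rule tensor_lift_fubini[OF LL.tensor_factors_axioms LL.tensor_factors_axioms
     comult_closed[OF assms(1)] comult_closed[OF assms(2)] assms(3,4)])

end

section \<open>The dual space\<close>

context hopf_algebra
begin

abbreviation "D \<equiv> dual_algebra L"

lemma dual_algebra_simps:
  "carrier D = functionals L \<inter> extensional (carrier L)"
  "\<zero>\<^bsub>D\<^esub> = (\<lambda>h\<in>carrier L. 0)"
  "f \<oplus>\<^bsub>D\<^esub> g = (\<lambda>h\<in>carrier L. f h + g h)"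
  "c \<odot>\<^bsub>D\<^esub> f = (\<lambda>h\<in>carrier L. c * f h)"
  "\<one>\<^bsub>D\<^esub> = restrict (counit L) (carrier L)"
  "f \<otimes>\<^bsub>D\<^esub> g = (\<lambda>h\<in>carrier L. sweedler (\<lambda>x y. f x * g y) h)"
  by (simp_all add: dual_algebra_def sweedler_def)

lemma restrict_in_dual: "\<phi> \<in> functionals L \<Longrightarrow> restrict \<phi> (carrier L) \<in> carrier D"
  by (simp add: dual_algebra_simps) (rule linear_maps_cong[OF _ _ module_axioms], simp_all)

lemma dual_functional: "f \<in> carrier D \<Longrightarrow> f \<in> functionals L"
  by (simp add: dual_algebra_simps)

lemma dual_eqI:
  assumes "f \<in> carrier D" "g \<in> carrier D" "\<And>x. x \<in> carrier L \<Longrightarrow> f x = g x"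
  shows "f = g"
  using assms by (auto simp: dual_algebra_simps intro: extensionalityI)

sublocale D: Module.module class_ring D
proof -
  have cr: "cring (class_ring :: 'k ring)" ..
  have add: "f \<oplus>\<^bsub>D\<^esub> g \<in> carrier D" if "f \<in> carrier D" "g \<in> carrier D" for f g
    using restrict_in_dual[OF functional_add[OF that[THEN dual_functional]]] by (simp add: dual_algebra_simps)
  have scale: "c \<odot>\<^bsub>D\<^esub> f \<in> carrier D" if "f \<in> carrier D" for c f
    using restrict_in_dual[OF functional_mult_left[OF dual_functional[OF that]]] by (simp add: dual_algebra_simps)
  have zero: "\<zero>\<^bsub>D\<^esub> \<in> carrier D"
    using restrict_in_dual[OF functional_zero] by (simp add: dual_algebra_simps)
  have ev: "(f \<oplus>\<^bsub>D\<^esub> g) x = f x + g x" "(c \<odot>\<^bsub>D\<^esub> f) x = c * f x" "\<zero>\<^bsub>D\<^esub> x = 0" if "x \<in> carrier L" for f g c x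
    using that by (simp_all add: dual_algebra_simps)
  have neg: "\<forall>v\<in>carrier D. \<exists>w\<in>carrier D. v \<oplus>\<^bsub>D\<^esub> w = \<zero>\<^bsub>D\<^esub>"
  proof
    fix v assume v: "v \<in> carrier D"
    show "\<exists>w\<in>carrier D. v \<oplus>\<^bsub>D\<^esub> w = \<zero>\<^bsub>D\<^esub>"
      by (rule bexI[of _ "(- 1) \<odot>\<^bsub>D\<^esub> v"], rule dual_eqI) (simp_all add: v add scale zero ev)
  qed
  show "module class_ring D"
    by (rule module_criteria) (auto simp: cr neg add scale zero ev algebra_simps intro!: dual_eqI)
qed

lemma dual_eval: "x \<in> carrier L \<Longrightarrow> (\<lambda>f. f x) \<in> functionals D"
  by (rule linear_mapsI) (simp_all add: dual_algebra_simps)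

lemma linear_maps_dualI:
  assumes "\<And>x. x \<in> carrier X \<Longrightarrow> f x \<in> carrier D"
    and "\<And>a. a \<in> carrier L \<Longrightarrow> (\<lambda>x. f x a) \<in> functionals X" "module class_ring X"
  shows "f \<in> linear_maps X D"
proof -
  interpret X: Module.module class_ring X by fact
  note [simp] = X.smult_closed[simplified]
  have ev: "(f \<oplus>\<^bsub>D\<^esub> g) x = f x + g x" "(c \<odot>\<^bsub>D\<^esub> f) x = c * f x" if "x \<in> carrier L" for f g c x
    using that by (simp_all add: dual_algebra_simps)
  show ?thesis
    by (rule linear_mapsI)
      (auto intro!: dual_eqI assms D.smult_closed[simplified] simp: ev linear_mapsD[OF assms(2)])
qed

lemma product_form: "\<lbrakk>\<phi> \<in> functionals L; \<psi> \<in> functionals L\<rbrakk> \<Longrightarrow> bilinear_form (\<lambda>x y. \<phi> x * \<psi> y)"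
  by (intro bilinearI linear_intros)

lemma dual_mult_closed: "\<lbrakk>f \<in> carrier D; g \<in> carrier D\<rbrakk> \<Longrightarrow> f \<otimes>\<^bsub>D\<^esub> g \<in> carrier D"
  unfolding dual_algebra_simps(6)
  by (intro restrict_in_dual sweedler_linear product_form dual_functional)

lemma dual_action_closed: "\<lbrakk>h \<in> carrier L; g \<in> carrier D\<rbrakk> \<Longrightarrow> dual_action L h g \<in> carrier D"
  unfolding dual_action_def
  by (intro restrict_in_dual linear_maps_comp[OF _ dual_functional] linear_intros)

lemma dual_one_closed: "\<one>\<^bsub>D\<^esub> \<in> carrier D"
  unfolding dual_algebra_simps(5) by (rule restrict_in_dual[OF counit_linear])

abbreviation "H \<equiv> tensor_space L D"

sublocale LD: tensor_factors L D
  by (rule tensor_factors.intro) (rule module_axioms D.module_axioms)+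

lemma dual_mult_bilinear: "bilinear D D D (\<lambda>f g. f \<otimes>\<^bsub>D\<^esub> g)"
proof (intro bilinearI linear_maps_dualI dual_mult_closed D.module_axioms)
  fix f a assume f: "f \<in> carrier D" and a: "a \<in> carrier L"
  have "(\<lambda>g. sweedler (\<lambda>x y. f x * g y) a) \<in> functionals D"
    by (intro sweedler_linear_param D.module_axioms a product_form dual_functional f linear_intros dual_eval)
  then show "(\<lambda>g. (f \<otimes>\<^bsub>D\<^esub> g) a) \<in> functionals D" using a by (simp add: dual_algebra_simps)
  have "(\<lambda>g. sweedler (\<lambda>x y. g x * f y) a) \<in> functionals D"
    by (intro sweedler_linear_param D.module_axioms a product_form dual_functional f linear_intros dual_eval)
  then show "(\<lambda>g. (g \<otimes>\<^bsub>D\<^esub> f) a) \<in> functionals D" using a by (simp add: dual_algebra_simps)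
qed

lemma dual_action_bilinear: "bilinear L D D (dual_action L)"
proof (intro bilinearI linear_maps_dualI dual_action_closed D.module_axioms module_axioms)
  fix f h a assume a: "a \<in> carrier L"
  show "(\<lambda>f. dual_action L h f a) \<in> functionals D" if "h \<in> carrier L"
    using dual_eval[of "a \<otimes> h"] that a by (simp add: dual_action_def)
  assume f: "f \<in> carrier D"
  have "(\<lambda>h. f (a \<otimes> h)) \<in> functionals L"
    by (intro linear_maps_comp[OF _ dual_functional[OF f]] linear_intros a)
  then show "(\<lambda>h. dual_action L h f a) \<in> functionals L"
    using a by (simp add: dual_action_def)
qed

end

section \<open>The action on the dual space in coordinates\<close>

lemma module_module_mat: "module class_ring (module_mat TYPE('k::field) nr nc)"
  using matrix_vs[where 'a='k] by (simp add: vectorspace_def)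

lemma linear_maps_matI:
  assumes "\<And>p r. \<lbrakk>p < m; r < n\<rbrakk> \<Longrightarrow> (\<lambda>x. f x p r) \<in> functionals X"
  shows "(\<lambda>x. mat m n (\<lambda>(p, r). f x p r)) \<in> linear_maps X (module_mat TYPE('k::field) m n)"
  by (rule linear_mapsI) (auto simp: module_mat_simps linear_mapsD[OF assms] )

lemma mat_entry_functional:
  "\<lbrakk>p < m; r < n\<rbrakk> \<Longrightarrow> (\<lambda>M. M $$ (p, r)) \<in> functionals (module_mat TYPE('k::field) m n)"
  by (rule linear_mapsI) (simp_all add: module_mat_simps)

text \<open>A Hopf algebra with a basis \<open>e\<close> and its dual basis \<open>c\<close>.  That \<open>e\<close> generates is expressed through
  submodules, which is the form in which it is used: linear statements are checked on \<open>e\<close>.\<close>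

locale based_hopf_algebra = hopf_algebra L
  for L :: "('k::field, 'a, 'm) hopf_scheme" (structure) +
  fixes n :: nat and e :: "nat \<Rightarrow> 'a" and c :: "nat \<Rightarrow> 'a \<Rightarrow> 'k"
  assumes basis_closed: "i < n \<Longrightarrow> e i \<in> carrier L"
    and coord_closed: "i < n \<Longrightarrow> c i \<in> carrier D"
    and coord_basis: "\<lbrakk>i < n; j < n\<rbrakk> \<Longrightarrow> c i (e j) = (if i = j then 1 else 0)"
    and basis_generates: "\<lbrakk>submodule class_ring N L; \<And>i. i < n \<Longrightarrow> e i \<in> N\<rbrakk> \<Longrightarrow> N = carrier L"
begin

abbreviation "M \<equiv> module_mat TYPE('k) n n"

lemma coord_functional: "i < n \<Longrightarrow> c i \<in> functionals L"
  by (rule dual_functional[OF coord_closed])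

lemma functional_expand:
  assumes "\<phi> \<in> functionals L" "x \<in> carrier L"
  shows "\<phi> x = (\<Sum>i<n. c i x * \<phi> (e i))"
proof -
  have "(\<lambda>x. \<Sum>i<n. c i x * \<phi> (e i)) \<in> functionals L"
    by (intro functional_sum functional_mult_right coord_functional) simp
  from basis_generates[OF linear_maps_equalizer[OF module_axioms module_field_algebra assms(1) this]]
  have "{x \<in> carrier L. \<phi> x = (\<Sum>i<n. c i x * \<phi> (e i))} = carrier L"
    by (simp add: basis_closed coord_basis if_distrib[where f = "\<lambda>z. z * _"] sum.delta cong: if_cong)
  then show ?thesis using assms(2) by blast
qed

lemma dual_generated:
  assumes "submodule class_ring N D" "\<And>i. i < n \<Longrightarrow> c i \<in> N"
  shows "N = carrier D"
proof (rule submodule_eqI[OF assms(1)], rule subsetI)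
  interpret N: LinearCombinations.submodule class_ring N D by fact
  fix f assume f: "f \<in> carrier D"
  have "m \<le> n \<Longrightarrow> (\<lambda>x\<in>carrier L. \<Sum>i<m. f (e i) * c i x) \<in> N" for m
  proof (induction m)
    case 0
    show ?case using N.zero_closed by (simp only: dual_algebra_simps lessThan_0 sum.empty)
  next
    case (Suc m)
    have "(\<lambda>x\<in>carrier L. \<Sum>i<Suc m. f (e i) * c i x)
      = (\<lambda>x\<in>carrier L. \<Sum>i<m. f (e i) * c i x) \<oplus>\<^bsub>D\<^esub> f (e m) \<odot>\<^bsub>D\<^esub> c m"
      by (auto simp: dual_algebra_simps restrict_def)
    moreover have "(\<lambda>x\<in>carrier L. \<Sum>i<m. f (e i) * c i x) \<oplus>\<^bsub>D\<^esub> f (e m) \<odot>\<^bsub>D\<^esub> c m \<in> N"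
      using Suc.prems by (intro N.m_closed N.smult_closed Suc.IH assms(2)) simp_all
    ultimately show ?case by (simp only:)
  qed
  from this[of n] have "(\<lambda>x\<in>carrier L. \<Sum>i<n. f (e i) * c i x) \<in> N" by simp
  also have "(\<lambda>x\<in>carrier L. \<Sum>i<n. f (e i) * c i x) = f"
    using f functional_expand[OF dual_functional[OF f]]
    by (intro extensionalityI[of _ "carrier L"]) (auto simp: dual_algebra_simps mult.commute)
  finally show "f \<in> N" .
qed

text \<open>The matrix of \<open>g \<mapsto> f * (h \<cdot> g)\<close> on the dual space in the basis \<open>c\<close>: the entry \<open>(p, r)\<close> is the value
  of \<open>f * (h \<cdot> c r)\<close> at \<open>e p\<close>.\<close>

definition rep_matrix :: "'a \<Rightarrow> ('a \<Rightarrow> 'k) \<Rightarrow> 'k mat" where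
  "rep_matrix h f = mat n n (\<lambda>(p, r). sweedler (\<lambda>x y. f x * c r (y \<otimes> h)) (e p))"

lemma rep_matrix_closed: "rep_matrix h f \<in> carrier_mat n n"
  by (simp add: rep_matrix_def)

lemma rep_matrix_index: "\<lbrakk>p < n; r < n\<rbrakk> \<Longrightarrow> rep_matrix h f $$ (p, r) = sweedler (\<lambda>x y. f x * c r (y \<otimes> h)) (e p)"
  by (simp add: rep_matrix_def)

lemma action_form:
  assumes "f \<in> functionals L" "g \<in> functionals L" "h \<in> carrier L"
  shows "bilinear_form (\<lambda>x y. f x * g (y \<otimes> h))"
  by (intro bilinearI linear_intros linear_maps_comp[OF _ assms(2)] assms)

lemma rep_matrix_bilinear: "bilinear L D M rep_matrix"
proof (rule bilinearI)
  fix h assume h: "h \<in> carrier L"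
  show "rep_matrix h \<in> linear_maps D M"
    unfolding rep_matrix_def[abs_def]
    by (intro linear_maps_matI sweedler_linear_param D.module_axioms basis_closed action_form
        dual_functional coord_functional h linear_intros dual_eval)
next
  fix f assume f: "f \<in> carrier D"
  show "(\<lambda>h. rep_matrix h f) \<in> linear_maps L M"
    unfolding rep_matrix_def[abs_def]
    by (intro linear_maps_matI sweedler_linear_param module_axioms basis_closed action_form
        dual_functional coord_functional f linear_maps_comp[OF _ coord_functional] linear_intros)
qed

text \<open>The coordinates of a functional \<open>g\<close> are its values \<open>g (e r)\<close>, so the left-hand side is the
  \<open>p\<close>-th coordinate of the matrix applied to \<open>g\<close>.\<close>

lemma rep_matrix_action:
  assumes "h \<in> carrier L" "f \<in> functionals L" "g \<in> functionals L" "p < n"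
  shows "(\<Sum>r<n. rep_matrix h f $$ (p, r) * g (e r)) = sweedler (\<lambda>x y. f x * g (y \<otimes> h)) (e p)"
proof -
  have b: "bilinear_form (\<lambda>x y. f x * c r (y \<otimes> h))" if "r < n" for r
    by (rule action_form[OF assms(2) coord_functional[OF that] assms(1)])
  have b': "bilinear_form (\<lambda>x y. g (e r) * (f x * c r (y \<otimes> h)))" if "r < n" for r
    by (intro bilinearI functional_mult_left bilinearD[OF b[OF that]])
  have "(\<Sum>r<n. rep_matrix h f $$ (p, r) * g (e r)) = (\<Sum>r<n. sweedler (\<lambda>x y. g (e r) * (f x * c r (y \<otimes> h))) (e p))"
    using assms(4) by (simp add: rep_matrix_index sweedler_scale[OF b] basis_closed mult.commute)
  also have "\<dots> = sweedler (\<lambda>x y. \<Sum>r<n. g (e r) * (f x * c r (y \<otimes> h))) (e p)"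
    by (rule sweedler_sum[symmetric]) (simp_all add: b' basis_closed assms)
  also have "\<dots> = sweedler (\<lambda>x y. f x * g (y \<otimes> h)) (e p)"
    by (rule sweedler_cong[OF action_form[OF assms(2,3,1)], symmetric])
      (simp_all add: basis_closed assms functional_expand[OF assms(3), of "_ \<otimes> h"] sum_distrib_left mult_ac)
  finally show ?thesis .
qed

text \<open>The entry of \<open>f * (h \<cdot> (f' * (g \<cdot> c s)))\<close> at \<open>e p\<close>.  The module algebra property moves \<open>h\<close> past the
  inner convolution, which leaves \<open>f * (h\<^sub>1 \<cdot> f') * (h\<^sub>2 g \<cdot> c s)\<close>; coassociativity rebrackets the two
  convolutions.\<close>

lemma rep_matrix_mult_index:
  assumes h: "h \<in> carrier L" and f: "f \<in> carrier D" and g: "g \<in> carrier L" and f': "f' \<in> carrier D"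
    and p: "p < n" and s: "s < n"
  shows "(rep_matrix h f * rep_matrix g f') $$ (p, s)
    = sweedler (\<lambda>h1 h2. rep_matrix (h2 \<otimes> g) (f \<otimes>\<^bsub>D\<^esub> dual_action L h1 f') $$ (p, s)) h"
proof -
  note F = dual_functional[OF f] and F' = dual_functional[OF f'] and C = coord_functional[OF s]
    and ep = basis_closed[OF p]
  define K where "K a b h1 h2 = f' (a \<otimes> h1) * c s ((b \<otimes> h2) \<otimes> g)" for a b h1 h2
  note I = linear_intros linear_maps_comp[OF _ F'] linear_maps_comp[OF _ C] m_closed g
  have K1: "bilinear_form (K a b)" if "a \<in> carrier L" "b \<in> carrier L" for a b
    unfolding K_def[abs_def] by (intro bilinearI I that)
  have K2: "bilinear_form (\<lambda>a b. K a b h1 h2)" if "h1 \<in> carrier L" "h2 \<in> carrier L" for h1 h2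
    unfolding K_def[abs_def] by (intro bilinearI I that)
  have G: "bilinear_form (\<lambda>x y. f' x * c s (y \<otimes> g))" by (rule action_form[OF F' C g])
  have SK: "bilinear_form (\<lambda>h1 h2. sweedler (\<lambda>a b. K a b h1 h2) y)" if "y \<in> carrier L" for y
    by (intro bilinearI sweedler_linear_param module_axioms that K2 bilinearD[OF K1])
  have KS: "bilinear_form (\<lambda>a b. sweedler (K a b) h)"
    by (intro bilinearI sweedler_linear_param module_axioms h K1 bilinearD[OF K2])
  have "(rep_matrix h f * rep_matrix g f') $$ (p, s) = (\<Sum>r<n. rep_matrix h f $$ (p, r) * sweedler (\<lambda>x y. f' x * c s (y \<otimes> g)) (e r))"
    using p s rep_matrix_closed[of h f] rep_matrix_closed[of g f']
    by (auto simp: scalar_prod_def rep_matrix_index lessThan_atLeast0 intro!: sum.cong)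
  also have "\<dots> = sweedler (\<lambda>x y. f x * sweedler (\<lambda>x y. f' x * c s (y \<otimes> g)) (y \<otimes> h)) (e p)"
    by (rule rep_matrix_action[OF h F sweedler_linear[OF G] p])
  also have "\<dots> = sweedler (\<lambda>x y. f x * sweedler (\<lambda>a b. sweedler (K a b) h) y) (e p)"
    by (rule sweedler_cong[OF action_form[OF F sweedler_linear[OF G] h] ep])
      (simp add: sweedler_mult[OF G _ h] K_def[abs_def])
  also have "\<dots> = sweedler (\<lambda>x y. sweedler (\<lambda>h1 h2. f x * sweedler (\<lambda>a b. K a b h1 h2) y) h) (e p)"
    by (rule sweedler_cong[OF product_form[OF F sweedler_linear[OF KS]] ep])
      (simp add: sweedler_swap[OF _ h K2 K1] sweedler_scale[OF SK h])
  also have "\<dots> = sweedler (\<lambda>h1 h2. sweedler (\<lambda>x y. f x * sweedler (\<lambda>a b. K a b h1 h2) y) (e p)) h"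
    by (rule sweedler_swap[OF ep h])
      (intro product_form[OF F] sweedler_linear K2 bilinearI functional_mult_left bilinearD[OF SK]; assumption)+
  also have "\<dots> = sweedler (\<lambda>h1 h2. rep_matrix (h2 \<otimes> g) (f \<otimes>\<^bsub>D\<^esub> dual_action L h1 f') $$ (p, s)) h"
  proof (rule sweedler_cong[OF _ h])
    show "bilinear_form (\<lambda>h1 h2. sweedler (\<lambda>x y. f x * sweedler (\<lambda>a b. K a b h1 h2) y) (e p))"
      by (intro bilinearI sweedler_linear_param module_axioms ep product_form[OF F] sweedler_linear K2
          functional_mult_left bilinearD[OF SK]; assumption)
    fix h1 h2 assume h1: "h1 \<in> carrier L" and h2: "h2 \<in> carrier L"
    have tri: "trilinear_form (\<lambda>x a b. f x * K a b h1 h2)"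
      unfolding K_def by (intro trilinear_formI I h1 h2 F)
    have conv: "(f \<otimes>\<^bsub>D\<^esub> dual_action L h1 f') x = sweedler (\<lambda>u a. f u * f' (a \<otimes> h1)) x" if "x \<in> carrier L" for x
      using that unfolding dual_algebra_simps(6)
      by (simp, intro sweedler_cong product_form F dual_functional dual_action_closed h1 f')
        (simp_all add: dual_action_def)
    have fh: "bilinear_form (\<lambda>u a. f u * f' (a \<otimes> h1))" by (rule action_form[OF F F' h1])
    have "sweedler (\<lambda>x y. f x * sweedler (\<lambda>a b. K a b h1 h2) y) (e p)
      = sweedler (\<lambda>x y. sweedler (\<lambda>a b. f x * K a b h1 h2) y) (e p)"
      by (rule sweedler_cong[OF product_form[OF F sweedler_linear[OF K2[OF h1 h2]]] ep])
        (simp add: sweedler_scale[OF K2[OF h1 h2]])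
    also have "\<dots> = sweedler (\<lambda>x b. sweedler (\<lambda>u a. f u * K a b h1 h2) x) (e p)"
      by (rule sweedler_coassoc[OF tri ep, symmetric])
    also have "\<dots> = sweedler (\<lambda>x b. sweedler (\<lambda>u a. f u * f' (a \<otimes> h1)) x * c s (b \<otimes> (h2 \<otimes> g))) (e p)"
    proof (rule sweedler_cong[OF _ ep, symmetric])
      show "bilinear_form (\<lambda>x b. sweedler (\<lambda>u a. f u * f' (a \<otimes> h1)) x * c s (b \<otimes> (h2 \<otimes> g)))"
        by (rule action_form[OF sweedler_linear[OF fh] C]) (simp add: h2 g)
      show "sweedler (\<lambda>u a. f u * f' (a \<otimes> h1)) x * c s (b \<otimes> (h2 \<otimes> g)) = sweedler (\<lambda>u a. f u * K a b h1 h2) x"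
        if "x \<in> carrier L" "b \<in> carrier L" for x b
        using sweedler_scale[OF fh that(1), of "c s (b \<otimes> (h2 \<otimes> g))"] that h2 g
        by (simp add: K_def m_assoc mult_ac)
    qed
    also have "\<dots> = rep_matrix (h2 \<otimes> g) (f \<otimes>\<^bsub>D\<^esub> dual_action L h1 f') $$ (p, s)"
      unfolding rep_matrix_index[OF p s]
      by (rule sweedler_cong[OF action_form[OF sweedler_linear[OF fh] C] ep]) (simp_all add: h2 g conv)
    finally show "sweedler (\<lambda>x y. f x * sweedler (\<lambda>a b. K a b h1 h2) y) (e p) =
      rep_matrix (h2 \<otimes> g) (f \<otimes>\<^bsub>D\<^esub> dual_action L h1 f') $$ (p, s)" .
  qed
  finally show ?thesis .
qed

end

section \<open>The product of the Heisenberg double\<close>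

lemma linear_maps_mat_mult:
  assumes "B \<in> carrier_mat n n"
  shows "(\<lambda>A. A * B) \<in> linear_maps (module_mat TYPE('k::field) n n) (module_mat TYPE('k) n n)"
    and "(\<lambda>A. B * A) \<in> linear_maps (module_mat TYPE('k::field) n n) (module_mat TYPE('k) n n)"
  using assms
  by (auto intro!: linear_mapsI simp: module_mat_simps add_mult_distrib_mat mult_add_distrib_mat
      mult_smult_distrib[OF assms] mult_smult_assoc_mat)

context hopf_algebra
begin

text \<open>The product of the pure tensors \<open>h # f\<close> and \<open>g # f'\<close>.\<close>

definition heisenberg_product :: "'a \<Rightarrow> ('a \<Rightarrow> 'k) \<Rightarrow> 'a \<Rightarrow> ('a \<Rightarrow> 'k) \<Rightarrow> ('a, 'a \<Rightarrow> 'k, 'k) tensor" where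
  "heisenberg_product h f g f' = tensor_lift H (\<lambda>h1 h2.
     pure_tensor L D (h2 \<otimes> g) (f \<otimes>\<^bsub>D\<^esub> dual_action L h1 f')) (comult L h)"

abbreviation "HD \<equiv> heisenberg_double L"

lemma heisenberg_double_simps:
  "carrier HD = carrier H" "\<zero>\<^bsub>HD\<^esub> = \<zero>\<^bsub>H\<^esub>" "\<one>\<^bsub>HD\<^esub> = pure_tensor L D \<one> \<one>\<^bsub>D\<^esub>"
  "s \<oplus>\<^bsub>HD\<^esub> t = s \<oplus>\<^bsub>H\<^esub> t" "a \<odot>\<^bsub>HD\<^esub> s = a \<odot>\<^bsub>H\<^esub> s"
  "s \<otimes>\<^bsub>HD\<^esub> t = tensor_lift H (\<lambda>h f. tensor_lift H (heisenberg_product h f) t) s"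
  by (simp_all add: heisenberg_double_def Let_def heisenberg_product_def[abs_def])

lemmas product_intros = bilinearD[OF LD.pure_tensor_bilinear]
  linear_maps_comp[OF _ bilinearD(1)[OF LD.pure_tensor_bilinear]]
  linear_maps_comp[OF _ bilinearD(2)[OF LD.pure_tensor_bilinear]]
  linear_maps_comp[OF _ bilinearD(1)[OF dual_mult_bilinear]]
  bilinearD(2)[OF dual_mult_bilinear] bilinearD[OF dual_action_bilinear]
  linear_maps_id linear_maps_mult_left linear_maps_mult_right
  dual_mult_closed dual_action_closed m_closed

lemma heisenberg_product_inner:
  assumes "f \<in> carrier D" "g \<in> carrier L" "f' \<in> carrier D"
  shows "bilinear L L H (\<lambda>h1 h2. pure_tensor L D (h2 \<otimes> g) (f \<otimes>\<^bsub>D\<^esub> dual_action L h1 f'))"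
  by (intro bilinearI product_intros assms)

lemma heisenberg_product_linear:
  "\<lbrakk>f \<in> carrier D; g \<in> carrier L; f' \<in> carrier D\<rbrakk> \<Longrightarrow> (\<lambda>h. heisenberg_product h f g f') \<in> linear_maps L H"
  "\<lbrakk>h \<in> carrier L; g \<in> carrier L; f' \<in> carrier D\<rbrakk> \<Longrightarrow> (\<lambda>f. heisenberg_product h f g f') \<in> linear_maps D H"
  "\<lbrakk>h \<in> carrier L; f \<in> carrier D; f' \<in> carrier D\<rbrakk> \<Longrightarrow> (\<lambda>g. heisenberg_product h f g f') \<in> linear_maps L H"
  "\<lbrakk>h \<in> carrier L; f \<in> carrier D; g \<in> carrier L\<rbrakk> \<Longrightarrow> (\<lambda>f'. heisenberg_product h f g f') \<in> linear_maps D H"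
  unfolding heisenberg_product_def
  by (intro LL.tensor_lift_linear_param LD.T.module_axioms module_axioms D.module_axioms comult_closed
     heisenberg_product_inner linear_maps_comp[OF comult_linear LL.tensor_lift_linear] product_intros; assumption)+

lemma heisenberg_product_bilinear:
  assumes "h \<in> carrier L" "f \<in> carrier D"
  shows "bilinear L D H (heisenberg_product h f)"
  by (intro bilinearI heisenberg_product_linear assms; assumption)

lemma heisenberg_mult_bilinear:
  assumes "t \<in> carrier H"
  shows "bilinear L D H (\<lambda>h f. tensor_lift H (heisenberg_product h f) t)"
  by (intro bilinearI LD.tensor_lift_linear_param LD.T.module_axioms module_axioms D.module_axioms
     heisenberg_product_bilinear heisenberg_product_linear assms; assumption)

lemma heisenberg_mult_linear:
  assumes "t \<in> carrier H"
  shows "(\<lambda>s. s \<otimes>\<^bsub>HD\<^esub> t) \<in> linear_maps H H"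
    and "(\<lambda>s. t \<otimes>\<^bsub>HD\<^esub> s) \<in> linear_maps H H"
  unfolding heisenberg_double_simps
  by (intro LD.tensor_lift_linear heisenberg_mult_bilinear LD.T.module_axioms assms
      LD.tensor_lift_linear_param heisenberg_product_bilinear; assumption)+

lemma heisenberg_mult_pure:
  assumes "h \<in> carrier L" "f \<in> carrier D" "g \<in> carrier L" "f' \<in> carrier D"
  shows "pure_tensor L D h f \<otimes>\<^bsub>HD\<^esub> pure_tensor L D g f' = heisenberg_product h f g f'"
  using assms
  by (simp add: heisenberg_double_simps LD.tensor_lift_pure[OF LD.T.module_axioms]
     heisenberg_mult_bilinear LD.pure_tensor_closed heisenberg_product_bilinear)

lemma heisenberg_mult_closed: "\<lbrakk>s \<in> carrier H; t \<in> carrier H\<rbrakk> \<Longrightarrow> s \<otimes>\<^bsub>HD\<^esub> t \<in> carrier H"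
  by (rule linear_mapsD(1)[OF heisenberg_mult_linear(1)])

end

context based_hopf_algebra
begin

definition rep :: "('a, 'a \<Rightarrow> 'k, 'k) tensor \<Rightarrow> 'k mat" where
  "rep = tensor_lift M rep_matrix"

lemma rep_linear: "rep \<in> linear_maps H M"
  unfolding rep_def by (rule LD.tensor_lift_linear[OF module_module_mat rep_matrix_bilinear])

lemma rep_pure: "\<lbrakk>h \<in> carrier L; f \<in> carrier D\<rbrakk> \<Longrightarrow> rep (pure_tensor L D h f) = rep_matrix h f"
  unfolding rep_def by (rule LD.tensor_lift_pure[OF module_module_mat rep_matrix_bilinear])

lemma rep_closed: "t \<in> carrier H \<Longrightarrow> rep t \<in> carrier_mat n n"
  using linear_mapsD(1)[OF rep_linear] by (simp add: module_mat_simps)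

lemma rep_product:
  assumes "h \<in> carrier L" "f \<in> carrier D" "g \<in> carrier L" "f' \<in> carrier D"
  shows "rep (heisenberg_product h f g f') = rep_matrix h f * rep_matrix g f'"
proof (rule eq_matI)
  have "heisenberg_product h f g f' \<in> carrier H"
    by (rule bilinear_closed[OF heisenberg_product_bilinear[OF assms(1,2)] assms(3,4)])
  from rep_closed[OF this]
  show "dim_row (rep (heisenberg_product h f g f')) = dim_row (rep_matrix h f * rep_matrix g f')"
    "dim_col (rep (heisenberg_product h f g f')) = dim_col (rep_matrix h f * rep_matrix g f')"
    using rep_matrix_closed[of h f] rep_matrix_closed[of g f'] by auto
  fix p s assume "p < dim_row (rep_matrix h f * rep_matrix g f')" "s < dim_col (rep_matrix h f * rep_matrix g f')"
  then have p: "p < n" and s: "s < n" using rep_matrix_closed[of h f] rep_matrix_closed[of g f'] by auto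
  note inner = heisenberg_product_inner[OF assms(2-4)]
  note ent = linear_maps_comp[OF rep_linear mat_entry_functional[OF p s]]
  have "rep (heisenberg_product h f g f') $$ (p, s) =
    sweedler (\<lambda>h1 h2. rep (pure_tensor L D (h2 \<otimes> g) (f \<otimes>\<^bsub>D\<^esub> dual_action L h1 f')) $$ (p, s)) h"
    unfolding heisenberg_product_def
    by (rule functional_tensor_lift[OF LD.T.module_axioms inner ent assms(1)])
  also have "\<dots> = sweedler (\<lambda>h1 h2. rep_matrix (h2 \<otimes> g) (f \<otimes>\<^bsub>D\<^esub> dual_action L h1 f') $$ (p, s)) h"
    by (rule sweedler_cong[OF bilinear_comp[OF inner ent] assms(1)])
      (simp add: rep_pure dual_mult_closed dual_action_closed assms)
  also have "\<dots> = (rep_matrix h f * rep_matrix g f') $$ (p, s)"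
    by (rule rep_matrix_mult_index[OF assms p s, symmetric])
  finally show "rep (heisenberg_product h f g f') $$ (p, s) = (rep_matrix h f * rep_matrix g f') $$ (p, s)" .
qed

text \<open>Both sides are bilinear, so it suffices to compare them on pure tensors.\<close>

lemma rep_mult:
  assumes s: "s \<in> carrier H" and t: "t \<in> carrier H"
  shows "rep (s \<otimes>\<^bsub>HD\<^esub> t) = rep s * rep t"
proof (rule LD.linear_maps_tensor_eqI[OF module_module_mat _ _ _ s])
  show "(\<lambda>s. rep (s \<otimes>\<^bsub>HD\<^esub> t)) \<in> linear_maps H M"
    by (rule linear_maps_comp[OF heisenberg_mult_linear(1)[OF t] rep_linear])
  show "(\<lambda>s. rep s * rep t) \<in> linear_maps H M"
    by (rule linear_maps_comp[OF rep_linear linear_maps_mat_mult(1)[OF rep_closed[OF t]]])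
  fix h f assume h: "h \<in> carrier L" and f: "f \<in> carrier D"
  have hf: "pure_tensor L D h f \<in> carrier H" by (rule LD.pure_tensor_closed[OF h f])
  show "rep (pure_tensor L D h f \<otimes>\<^bsub>HD\<^esub> t) = rep (pure_tensor L D h f) * rep t"
  proof (rule LD.linear_maps_tensor_eqI[OF module_module_mat _ _ _ t])
    show "(\<lambda>t. rep (pure_tensor L D h f \<otimes>\<^bsub>HD\<^esub> t)) \<in> linear_maps H M"
      by (rule linear_maps_comp[OF heisenberg_mult_linear(2)[OF hf] rep_linear])
    show "(\<lambda>t. rep (pure_tensor L D h f) * rep t) \<in> linear_maps H M"
      by (rule linear_maps_comp[OF rep_linear linear_maps_mat_mult(2)[OF rep_closed[OF hf]]])
    show "rep (pure_tensor L D h f \<otimes>\<^bsub>HD\<^esub> pure_tensor L D g f')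
       = rep (pure_tensor L D h f) * rep (pure_tensor L D g f')"
      if "g \<in> carrier L" "f' \<in> carrier D" for g f'
      using that h f by (simp add: heisenberg_mult_pure rep_product rep_pure)
  qed
qed

lemma rep_one: "rep \<one>\<^bsub>HD\<^esub> = 1\<^sub>m n"
proof (rule eq_matI)
  have 1: "rep \<one>\<^bsub>HD\<^esub> = rep_matrix \<one> \<one>\<^bsub>D\<^esub>"
    by (simp add: heisenberg_double_simps rep_pure dual_one_closed)
  show "dim_row (rep \<one>\<^bsub>HD\<^esub>) = dim_row (1\<^sub>m n)" "dim_col (rep \<one>\<^bsub>HD\<^esub>) = dim_col (1\<^sub>m n)"
    unfolding 1 by (simp_all add: rep_matrix_def)
  fix p s assume "p < dim_row (1\<^sub>m n)" "s < dim_col (1\<^sub>m n)"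
  then have p: "p < n" and s: "s < n" by auto
  note c = coord_functional[OF s]
  have "rep_matrix \<one> \<one>\<^bsub>D\<^esub> $$ (p, s) = sweedler (\<lambda>x y. counit L x * c s y) (e p)"
    unfolding rep_matrix_index[OF p s]
    by (rule sweedler_cong[OF product_form[OF counit_linear c] basis_closed[OF p], symmetric])
      (simp add: dual_algebra_simps)
  also have "\<dots> = c s (e p)"
    by (rule sweedler_counit_left[OF c basis_closed[OF p]])
  finally show "rep \<one>\<^bsub>HD\<^esub> $$ (p, s) = 1\<^sub>m n $$ (p, s)"
    using p s unfolding 1 by (simp add: coord_basis)
qed

end

section \<open>Finite-dimensional linear algebra\<close>

lemma (in vectorspace) subspace_fin_dim:
  assumes "fin_dim" "subspace K W V"
  shows "vectorspace.fin_dim K (vs W)"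
proof -
  interpret W: vectorspace K "vs W" by (rule subspace_is_vs[OF assms(2)])
  have sub: "submodule K W V" and WV: "W \<subseteq> carrier V"
    using assms(2) is_module by (auto simp: submodule_def)
  have li: "W.lin_dep S = lin_dep S" if "S \<subseteq> W" for S
    by (rule span_li_not_depend(2)[OF that sub])
  have "W.lin_indpt {}" by (simp add: W.lin_dep_def)
  moreover have "finite S \<and> card S \<le> dim" if "S \<subseteq> carrier (vs W) \<and> W.lin_indpt S" for S
    using that li[of S] li_le_dim[OF assms(1), of S] WV fin_dim_li_fin[OF assms(1)] by auto
  ultimately obtain S where S: "finite S" "maximal S (\<lambda>S. S \<subseteq> carrier (vs W) \<and> W.lin_indpt S)"
    using maximal_exists[of "\<lambda>S. S \<subseteq> carrier (vs W) \<and> W.lin_indpt S" dim "{}"] by auto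
  then have "W.basis S" by (intro W.max_li_is_basis)
  then show ?thesis using S(1) by (auto simp: W.fin_dim_def W.basis_def)
qed

lemma (in vectorspace) injective_endomorphism_onto:
  assumes "fin_dim" "T \<in> LinearCombinations.module_hom K V V" "inj_on T (carrier V)"
  shows "T ` carrier V = carrier V"
proof -
  interpret T: linear_map K V V T
    by (intro linear_map.intro mod_hom.intro mod_hom_axioms.intro vectorspace_axioms module_axioms assms(2))
  let ?I = "vs (T ` carrier V)"
  have sub: "subspace K (T ` carrier V) V" using T.imT_is_subspace by (simp add: T.im_def)
  then have subm: "submodule K (T ` carrier V) V" by (rule is_module)
  interpret I: vectorspace K ?I by (rule subspace_is_vs[OF sub])
  have "T \<in> LinearCombinations.module_hom K V ?I"
    using assms(2) by (auto simp: LinearCombinations.module_hom_def)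
  then interpret TI: linear_map K V ?I T
    by (intro linear_map.intro mod_hom.intro mod_hom_axioms.intro vectorspace_axioms I.vectorspace_axioms
        module_axioms I.module_axioms)
  obtain B where B: "finite B" "basis B" using finite_basis_exists[OF assms(1)] by blast
  have TB: "I.basis (T ` B)"
    by (rule TI.linear_inj_image_is_basis[OF assms(3) _ B(2) assms(1)]) simp
  then have "T ` B \<subseteq> T ` carrier V" "lin_indpt (T ` B)"
    using span_li_not_depend(2)[OF _ subm, of "T ` B"] by (auto simp: I.basis_def)
  moreover have "card (T ` B) = dim"
    using B dim_basis[OF B] assms(3) by (metis basis_def card_image inj_on_subset)
  ultimately have "basis (T ` B)"
    using B(1) assms(1) linear_mapsD T.f_im by (intro dim_li_is_basis) auto
  then have "carrier V \<subseteq> T ` carrier V"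
    using span_is_subset[OF \<open>T ` B \<subseteq> T ` carrier V\<close> subm] by (simp add: basis_def)
  then show ?thesis using T.f_im by blast
qed

lemma dual_basis_exists:
  fixes V :: "('k::field, 'v, 'm) module_scheme"
  assumes "vectorspace class_ring V" "vectorspace.fin_dim class_ring V"
  obtains e c where "\<And>i. i < vectorspace.dim class_ring V \<Longrightarrow> e i \<in> carrier V"
    and "\<And>i. i < vectorspace.dim class_ring V \<Longrightarrow> c i \<in> functionals V"
    and "\<And>i j. \<lbrakk>i < vectorspace.dim class_ring V; j < vectorspace.dim class_ring V\<rbrakk> \<Longrightarrow>
           c i (e j) = (if i = j then 1 else 0)"
    and "\<And>N. \<lbrakk>submodule class_ring N V; \<And>i. i < vectorspace.dim class_ring V \<Longrightarrow> e i \<in> N\<rbrakk> \<Longrightarrow> N = carrier V"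
proof -
  interpret V: vectorspace class_ring V by fact
  obtain B where B: "finite B" "V.basis B" using V.finite_basis_exists[OF assms(2)] by blast
  have BV: "B \<subseteq> carrier V" using B(2) by (simp add: V.basis_def)
  have dim: "V.dim = card B" by (rule V.dim_basis[OF B])
  obtain e where e: "bij_betw e {..<V.dim} B"
    using ex_bij_betw_nat_finite[OF B(1)] by (auto simp: dim lessThan_atLeast0)
  have eB: "e i \<in> B" if "i < V.dim" for i using e that by (auto simp: bij_betw_def)
  define crd where "crd v = (THE a. a \<in> B \<rightarrow>\<^sub>E carrier (class_ring :: 'k ring) \<and> V.lincomb a B = v)" for v
  have ex1: "\<exists>!a. a \<in> B \<rightarrow>\<^sub>E carrier (class_ring :: 'k ring) \<and> V.lincomb a B = v" if "v \<in> carrier V" for v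
    using V.basis_criterion[OF B(1) BV] B(2) that by blast
  have crd: "crd v \<in> B \<rightarrow>\<^sub>E carrier (class_ring :: 'k ring)" "V.lincomb (crd v) B = v" if "v \<in> carrier V" for v
    using theI'[OF ex1[OF that]] unfolding crd_def by blast+
  have crd_eq: "crd v b = a b" if "v \<in> carrier V" "V.lincomb a B = v" "b \<in> B" for v a b
  proof -
    have "V.lincomb (restrict a B) B = v"
      using V.lincomb_cong[OF refl BV, of "restrict a B" a] that(2) by simp
    moreover have "restrict a B \<in> B \<rightarrow>\<^sub>E carrier (class_ring :: 'k ring)" by simp
    ultimately have "crd v = restrict a B" using ex1[OF that(1)] crd[OF that(1)] by blast
    then show ?thesis using that(3) by simp
  qed
  have lin: "(\<lambda>v. crd v b) \<in> functionals V" if "b \<in> B" for b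
  proof (rule linear_mapsI)
    fix v w x assume v: "v \<in> carrier V"
    show "crd v b \<in> carrier field_algebra" by simp
    have "V.lincomb (\<lambda>b. x * crd v b) B = x \<odot>\<^bsub>V\<^esub> v"
      using V.lincomb_smult[OF BV, of "crd v" x] crd(2)[OF v] by simp
    then show "crd (x \<odot>\<^bsub>V\<^esub> v) b = x \<odot>\<^bsub>field_algebra\<^esub> crd v b"
      using crd_eq[of "x \<odot>\<^bsub>V\<^esub> v"] v that V.smult_closed[of x v] by simp
    assume w: "w \<in> carrier V"
    have "V.lincomb (\<lambda>b. crd v b + crd w b) B = v \<oplus>\<^bsub>V\<^esub> w"
      using V.lincomb_sum[OF B(1) BV, of "crd v" "crd w"] crd(2)[OF v] crd(2)[OF w] by simp
    then show "crd (v \<oplus>\<^bsub>V\<^esub> w) b = crd v b \<oplus>\<^bsub>field_algebra\<^esub> crd w b"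
      using crd_eq[of "v \<oplus>\<^bsub>V\<^esub> w"] v w that by simp
  qed
  have delta: "crd b' b = (if b = b' then 1 else 0)" if "b \<in> B" "b' \<in> B" for b b'
  proof (rule crd_eq)
    show "b' \<in> carrier V" using that BV by blast
    have "V.lincomb (\<lambda>b. if b = b' then 1 else 0) B
      = (1 \<odot>\<^bsub>V\<^esub> b') \<oplus>\<^bsub>V\<^esub> V.lincomb (\<lambda>b. if b = b' then 1 else 0) (B - {b'})"
      using V.lincomb_del2[OF B(1) BV, of "\<lambda>b. if b = b' then 1 else 0" b'] that(2) by simp
    also have "V.lincomb (\<lambda>b. if b = b' then 1 else 0) (B - {b'}) = \<zero>\<^bsub>V\<^esub>"
      unfolding V.lincomb_def using BV V.lmult_0[simplified] by (intro V.add.finprod_one_eqI) auto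
    finally show "V.lincomb (\<lambda>b. if b = b' then 1 else 0) B = b'"
      using BV that V.smult_one[simplified] by (auto simp: subset_iff)
  qed (rule that(1))
  show thesis
  proof (rule that[of e "\<lambda>i v. crd v (e i)"])
    show "e i \<in> carrier V" "(\<lambda>v. crd v (e i)) \<in> functionals V" if "i < V.dim" for i
      using eB[OF that] BV lin by auto
    show "crd (e j) (e i) = (if i = j then 1 else 0)" if "i < V.dim" "j < V.dim" for i j
      using delta[OF eB[OF that(1)] eB[OF that(2)]] e that by (auto simp: bij_betw_def inj_on_def)
    fix N assume N: "submodule class_ring N V" "\<And>i. i < V.dim \<Longrightarrow> e i \<in> N"
    have "B \<subseteq> N" using e N(2) by (auto simp: bij_betw_def)
    from V.span_is_subset[OF this N(1)] have "carrier V \<subseteq> N" using B(2) by (simp add: V.basis_def)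
    then show "N = carrier V" by (rule submodule_eqI[OF N(1)])
  qed
qed

lemma (in linear_map) surjective_dim_le_injective:
  assumes "V.fin_dim" "T ` carrier V = carrier W" "V.dim \<le> W.dim"
  shows "inj_on T (carrier V)"
proof -
  interpret Ker: vectorspace K "V.vs kerT" by (rule V.subspace_is_vs[OF kerT_is_subspace])
  have "imT = carrier W" using assms(2) by (simp add: im_def)
  then have "W.dim + Ker.dim = V.dim" using rank_nullity[OF assms(1)] by simp
  then have "Ker.dim = 0" using assms(3) by simp
  moreover obtain B where B: "finite B" "Ker.basis B"
    using Ker.finite_basis_exists[OF V.subspace_fin_dim[OF assms(1) kerT_is_subspace]] by blast
  ultimately have "Ker.basis {}" using Ker.dim_basis[OF B] by simp
  then have "carrier (V.vs kerT) = {\<zero>\<^bsub>V\<^esub>}" by (simp add: Ker.basis_def Ker.span_empty)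
  then show ?thesis by (rule Ke0_imp_inj)
qed

lemma dim_module_mat: "vectorspace.dim class_ring (module_mat TYPE('k::field) n m) = n * m"
proof -
  have "card ({..<n} \<times> {..<m}) = n * m" by simp
  then obtain b where b: "bij_betw b ({..<n} \<times> {..<m}) {..<n * m}"
    using finite_same_card_bij[of "{..<n} \<times> {..<m}" "{..<n * m}"] by (metis card_lessThan finite_SigmaI finite_lessThan)
  define d where "d = inv_into ({..<n} \<times> {..<m}) b"
  have d: "d x \<in> {..<n} \<times> {..<m}" "b (d x) = x" if "x < n * m" for x
    using that b unfolding d_def by (auto simp: bij_betw_def inv_into_into f_inv_into_f)
  have bd: "d (b x) = x" "b x < n * m" if "x \<in> {..<n} \<times> {..<m}" for x
    using that b unfolding d_def by (auto simp: bij_betw_def)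
  let ?V = "module_vec TYPE('k) (n * m)" and ?M = "module_mat TYPE('k) n m"
  let ?f = "\<lambda>v. mat n m (\<lambda>x. v $ b x) :: 'k mat"
  interpret V: vec_space "TYPE('k)" "n * m" .
  interpret M: vectorspace class_ring ?M by (rule matrix_vs)
  have lin: "?f \<in> linear_maps ?V ?M"
    using bd by (intro linear_mapsI) (auto simp: module_vec_simps module_mat_simps)
  interpret f: linear_map class_ring ?V ?M ?f
    by (intro linear_map.intro mod_hom.intro mod_hom_axioms.intro V.vectorspace_axioms M.vectorspace_axioms
        V.module_axioms M.module_axioms lin)
  have inj: "inj_on ?f (carrier ?V)"
  proof (rule inj_onI)
    fix v w assume vw: "v \<in> carrier ?V" "w \<in> carrier ?V" and eq: "?f v = ?f w"
    show "v = w"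
    proof (rule eq_vecI)
      fix i assume "i < dim_vec w"
      then have i: "i < n * m" using vw by (simp add: module_vec_simps)
      have "?f v $$ d i = ?f w $$ d i" using eq by simp
      then show "v $ i = w $ i" using d[OF i] by auto
    qed (use vw in \<open>simp add: module_vec_simps\<close>)
  qed
  have surj: "?f ` carrier ?V = carrier ?M"
  proof (intro equalityI subsetI)
    fix X :: "'k mat" assume X: "X \<in> carrier ?M"
    have "X = ?f (vec (n * m) (\<lambda>i. X $$ d i))"
      using X bd by (intro eq_matI) (auto simp: module_mat_simps)
    then show "X \<in> ?f ` carrier ?V" by (rule image_eqI) (simp add: module_vec_simps)
  qed (auto simp: module_mat_simps)
  show ?thesis using f.dim_eq[OF V.fin_dim inj surj] V.dim_is_n by simp
qed

lemma submodule_mat_sum: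
  assumes "submodule class_ring A (module_mat TYPE('k::field) n n)" "finite J" "\<And>j. j \<in> J \<Longrightarrow> F j \<in> A"
  shows "mat n n (\<lambda>x. \<Sum>j\<in>J. F j $$ x) \<in> A"
  using assms(2,3)
proof (induction J)
  interpret A: LinearCombinations.submodule class_ring A "module_mat TYPE('k) n n" by (rule assms(1))
  case empty
  have "mat n n (\<lambda>x. \<Sum>j\<in>{}. F j $$ x) = 0\<^sub>m n n" by (rule eq_matI) auto
  then show ?case using A.zero_closed by (simp add: module_mat_simps)
next
  interpret A: LinearCombinations.submodule class_ring A "module_mat TYPE('k) n n" by (rule assms(1))
  case (insert j J)
  have "F j \<in> carrier_mat n n" using A.subset insert.prems by (auto simp: module_mat_simps)
  then have "mat n n (\<lambda>x. \<Sum>j\<in>insert j J. F j $$ x) = F j + mat n n (\<lambda>x. \<Sum>j\<in>J. F j $$ x)"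
    using insert.hyps by (intro eq_matI) auto
  then show ?case using A.m_closed insert by (simp add: module_mat_simps)
qed

lemma sum_swap_pairs:
  fixes f :: "'i \<Rightarrow> 's \<Rightarrow> 'j \<Rightarrow> 'r \<Rightarrow> 'b::comm_monoid_add"
  shows "(\<Sum>i\<in>A. \<Sum>s\<in>B. \<Sum>j\<in>C. \<Sum>r\<in>D. f i s j r) = (\<Sum>j\<in>C. \<Sum>r\<in>D. \<Sum>i\<in>A. \<Sum>s\<in>B. f i s j r)"
proof -
  have "(\<Sum>i\<in>A. \<Sum>s\<in>B. \<Sum>j\<in>C. \<Sum>r\<in>D. f i s j r) = (\<Sum>i\<in>A. \<Sum>j\<in>C. \<Sum>s\<in>B. \<Sum>r\<in>D. f i s j r)"
    by (intro sum.cong refl) (rule sum.swap)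
  also have "\<dots> = (\<Sum>j\<in>C. \<Sum>i\<in>A. \<Sum>r\<in>D. \<Sum>s\<in>B. f i s j r)"
    by (subst sum.swap) (intro sum.cong refl, rule sum.swap)
  also have "\<dots> = (\<Sum>j\<in>C. \<Sum>r\<in>D. \<Sum>i\<in>A. \<Sum>s\<in>B. f i s j r)"
    by (intro sum.cong refl) (rule sum.swap)
  finally show ?thesis .
qed

lemma sum_mult_delta:
  fixes g :: "'r \<Rightarrow> 'b::semiring_0"
  assumes "finite A" "t \<in> A"
  shows "(\<Sum>r\<in>A. g r * (if r = t then x else 0)) = g t * x"
proof -
  have "(\<Sum>r\<in>A. g r * (if r = t then x else 0)) = (\<Sum>r\<in>A. if r = t then g r * x else 0)"
    by (rule sum.cong) auto
  then show ?thesis using assms by simp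
qed

section \<open>Recognising the full matrix algebra\<close>

text \<open>For a matrix \<open>P\<close> over a matrix algebra \<open>A\<close>, the equation \<open>G P = Y\<close> between rows over \<open>A\<close> is solvable
  over \<open>A\<close> itself as soon as \<open>P\<close> has a right inverse \<open>Q\<close>, possibly with entries outside \<open>A\<close>.  Indeed
  \<open>G \<mapsto> G P\<close> maps the finite-dimensional space of rows over \<open>A\<close> to itself, and \<open>Q\<close> makes it injective.
  \<open>Q i k s t\<close> is the entry \<open>(s, t)\<close> of the block \<open>(i, k)\<close>.\<close>

lemma block_row_equation_solvable:
  fixes A :: "'k::field mat set" and P :: "nat \<Rightarrow> nat \<Rightarrow> 'k mat"
  assumes sub: "submodule class_ring A (module_mat TYPE('k) n n)"
    and mult: "\<And>X Y. \<lbrakk>X \<in> A; Y \<in> A\<rbrakk> \<Longrightarrow> X * Y \<in> A"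
    and P: "\<And>j i. \<lbrakk>j < n; i < n\<rbrakk> \<Longrightarrow> P j i \<in> A"
    and PQ: "\<And>j k r t. \<lbrakk>j < n; k < n; r < n; t < n\<rbrakk> \<Longrightarrow>
      (\<Sum>i<n. \<Sum>s<n. P j i $$ (r, s) * Q i k s t) = (if j = k \<and> r = t then 1 else 0)"
    and Y: "\<And>i. i < n \<Longrightarrow> Y i \<in> A"
  obtains G where "\<And>j. j < n \<Longrightarrow> G j \<in> A"
    and "\<And>i p s. \<lbrakk>i < n; p < n; s < n\<rbrakk> \<Longrightarrow> (\<Sum>j<n. \<Sum>r<n. G j $$ (p, r) * P j i $$ (r, s)) = Y i $$ (p, s)"
proof -
  interpret A: LinearCombinations.submodule class_ring A "module_mat TYPE('k) n n" by (rule sub)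
  have Ac: "X \<in> carrier_mat n n" if "X \<in> A" for X using A.subset that by (auto simp: module_mat_simps)
  \<comment> \<open>A row of \<open>n\<close> blocks is stored as one vector, indexed by the triples \<open>(j, p, r)\<close> of a block number
    and a position in the block.\<close>
  define N where "N = card ({..<n} \<times> {..<n} \<times> {..<n})"
  obtain b where b: "bij_betw b ({..<n} \<times> {..<n} \<times> {..<n}) {..<N}"
    using finite_same_card_bij[of "{..<n} \<times> {..<n} \<times> {..<n}" "{..<N}"]
    by (metis N_def card_lessThan finite_SigmaI finite_lessThan)
  define d where "d = inv_into ({..<n} \<times> {..<n} \<times> {..<n}) b"
  have d: "d m \<in> {..<n} \<times> {..<n} \<times> {..<n}" "b (d m) = m" if "m < N" for m
    using that b unfolding d_def by (auto simp: bij_betw_def inv_into_into f_inv_into_f)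
  have bd: "d (b x) = x" "b x < N" if "x \<in> {..<n} \<times> {..<n} \<times> {..<n}" for x
    using that b unfolding d_def by (auto simp: bij_betw_def)
  define blk :: "'k vec \<Rightarrow> nat \<Rightarrow> 'k mat" where "blk v j = mat n n (\<lambda>(p, r). v $ b (j, p, r))" for v j
  define tup :: "(nat \<Rightarrow> 'k mat) \<Rightarrow> 'k vec" where "tup G = vec N (\<lambda>m. case d m of (j, p, r) \<Rightarrow> G j $$ (p, r))" for G
  have blk_dim: "dim_row (blk v j) = n" "dim_col (blk v j) = n" for v j by (simp_all add: blk_def)
  have blk_tup: "blk (tup G) j = G j" if "G j \<in> carrier_mat n n" "j < n" for G j
    using that bd by (auto simp: blk_def tup_def )
  have vec_eqI: "v = w" if "v \<in> carrier_vec N" "w \<in> carrier_vec N" "\<And>j. j < n \<Longrightarrow> blk v j = blk w j" for v w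
  proof (rule eq_vecI)
    fix m assume "m < dim_vec w"
    then have m: "m < N" using that by simp
    obtain j p r where jpr: "d m = (j, p, r)" "j < n" "p < n" "r < n" using d(1)[OF m] by (cases "d m") auto
    have "blk v j $$ (p, r) = blk w j $$ (p, r)" using that(3) jpr by simp
    then show "v $ m = w $ m" using jpr d(2)[OF m] by (simp add: blk_def)
  qed (use that in auto)
  let ?V = "module_vec TYPE('k) N"
  interpret V: vec_space "TYPE('k)" N .
  let ?W = "{v \<in> carrier_vec N. \<forall>j<n. blk v j \<in> A}"
  have add: "blk (v + w) j = blk v j + blk w j" if "v \<in> carrier_vec N" "w \<in> carrier_vec N" "j < n" for v w j
    using that bd by (auto simp: blk_def )
  have scale: "blk (a \<cdot>\<^sub>v v) j = a \<cdot>\<^sub>m blk v j" if "v \<in> carrier_vec N" "j < n" for v a j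
    using that bd by (auto simp: blk_def )
  have zero: "blk (0\<^sub>v N) j = 0\<^sub>m n n" if "j < n" for j
    using that bd by (auto simp: blk_def )
  have subW: "submodule class_ring ?W ?V"
    using A.m_closed A.smult_closed A.zero_closed
    by (auto intro!: LinearCombinations.submodule.intro V.module_axioms simp: module_vec_simps module_mat_simps add scale zero)
  have ssW: "subspace class_ring ?W ?V"
    by (intro subspace.intro subW V.vectorspace_axioms)
  interpret W: vectorspace class_ring "V.vs ?W" by (rule V.subspace_is_vs[OF ssW])
  have W_fin: "W.fin_dim" by (rule V.subspace_fin_dim[OF V.fin_dim ssW])
  define row where "row v i = mat n n (\<lambda>x. \<Sum>j<n. (blk v j * P j i) $$ x)" for v i
  have row_dim: "dim_row (row v i) = n" "dim_col (row v i) = n" for v i by (simp_all add: row_def)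
  have row_A: "row v i \<in> A" if "v \<in> ?W" "i < n" for v i
    unfolding row_def using that by (intro submodule_mat_sum[OF sub] mult P) auto
  have row_index: "row v i $$ (p, s) = (\<Sum>j<n. \<Sum>r<n. blk v j $$ (p, r) * P j i $$ (r, s))"
    if "i < n" "p < n" "s < n" for v i p s
  proof -
    have "(blk v j * P j i) $$ (p, s) = (\<Sum>r<n. blk v j $$ (p, r) * P j i $$ (r, s))" if "j < n" for j
      using Ac[OF P[OF that \<open>i < n\<close>]] \<open>p < n\<close> \<open>s < n\<close>
      by (auto simp: scalar_prod_def blk_def lessThan_atLeast0)
    then show ?thesis using \<open>p < n\<close> \<open>s < n\<close> by (simp add: row_def)
  qed
  define T where "T v = tup (row v)" for v
  have blk_T: "blk (T v) i = row v i" if "i < n" for v i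
    unfolding T_def by (rule blk_tup) (simp_all add: row_def that)
  have T_carrier: "T v \<in> carrier_vec N" for v by (simp add: T_def tup_def)
  have T_closed: "T v \<in> ?W" if "v \<in> ?W" for v
    using row_A[OF that] T_carrier by (simp add: blk_T)
  have row_add: "row (v + w) i = row v i + row w i"
    if "v \<in> carrier_vec N" "w \<in> carrier_vec N" "i < n" for v w i
    by (rule eq_matI) (simp_all add: row_index that add sum.distrib algebra_simps row_dim blk_dim)
  have row_scale: "row (a \<cdot>\<^sub>v v) i = a \<cdot>\<^sub>m row v i" if "v \<in> carrier_vec N" "i < n" for a v i
    by (rule eq_matI) (simp_all add: row_index that scale sum_distrib_left algebra_simps row_dim blk_dim)
  have "T \<in> LinearCombinations.module_hom class_ring (V.vs ?W) (V.vs ?W)"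
  proof (rule linear_mapsI)
    fix v w a assume "v \<in> carrier (V.vs ?W)"
    then have v: "v \<in> ?W" "v \<in> carrier_vec N" by auto
    show "T v \<in> carrier (V.vs ?W)" using T_closed[OF v(1)] by simp
    have "T (a \<cdot>\<^sub>v v) = a \<cdot>\<^sub>v T v"
      by (rule vec_eqI) (simp_all add: T_carrier v blk_T row_scale scale)
    then show "T (a \<odot>\<^bsub>V.vs ?W\<^esub> v) = a \<odot>\<^bsub>V.vs ?W\<^esub> T v" by (simp add: module_vec_simps)
    assume "w \<in> carrier (V.vs ?W)"
    then have w: "w \<in> carrier_vec N" by auto
    have "T (v + w) = T v + T w"
      by (rule vec_eqI) (simp_all add: T_carrier v w blk_T row_add add)
    then show "T (v \<oplus>\<^bsub>V.vs ?W\<^esub> w) = T v \<oplus>\<^bsub>V.vs ?W\<^esub> T w" by (simp add: module_vec_simps)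
  qed
  moreover have "inj_on T (carrier (V.vs ?W))"
  proof (rule inj_onI)
    \<comment> \<open>Multiplying \<open>v P\<close> by the right inverse gives back \<open>v\<close>.\<close>
    have recover: "(\<Sum>i<n. \<Sum>s<n. row v i $$ (p, s) * Q i k s t) = blk v k $$ (p, t)"
      if "k < n" "p < n" "t < n" for v k p t
    proof -
      have "(\<Sum>i<n. \<Sum>s<n. row v i $$ (p, s) * Q i k s t)
        = (\<Sum>i<n. \<Sum>s<n. \<Sum>j<n. \<Sum>r<n. blk v j $$ (p, r) * (P j i $$ (r, s) * Q i k s t))"
        using that by (simp add: row_index sum_distrib_right mult.assoc)
      also have "\<dots> = (\<Sum>j<n. \<Sum>r<n. \<Sum>i<n. \<Sum>s<n. blk v j $$ (p, r) * (P j i $$ (r, s) * Q i k s t))"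
        by (rule sum_swap_pairs)
      also have "\<dots> = (\<Sum>j<n. \<Sum>r<n. blk v j $$ (p, r) * (if j = k \<and> r = t then 1 else 0))"
        using that PQ by (simp flip: sum_distrib_left)
      also have "\<dots> = (\<Sum>j<n. if j = k then \<Sum>r<n. if r = t then blk v j $$ (p, r) else 0 else 0)"
        using that by (intro sum.cong refl) (auto simp: sum_mult_delta)
      also have "\<dots> = blk v k $$ (p, t)" using that by simp
      finally show ?thesis .
    qed
    fix v w assume v: "v \<in> carrier (V.vs ?W)" and w: "w \<in> carrier (V.vs ?W)" and eq: "T v = T w"
    have row_eq: "row v i = row w i" if "i < n" for i
      using blk_T[OF that, of v] blk_T[OF that, of w] eq by simp
    show "v = w"
    proof (rule vec_eqI)
      fix k assume k: "k < n"
      have "blk v k $$ (p, t) = blk w k $$ (p, t)" if "p < n" "t < n" for p t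
        unfolding recover[OF k that, symmetric] by (simp add: row_eq)
      then show "blk v k = blk w k" by (intro eq_matI) (simp_all add: blk_dim)
    qed (use v w in auto)
  qed
  ultimately have "T ` carrier (V.vs ?W) = carrier (V.vs ?W)"
    by (rule W.injective_endomorphism_onto[OF W_fin])
  moreover have "tup Y \<in> ?W" using Y Ac[OF Y] blk_tup[of Y] by (simp add: tup_def)
  ultimately have "tup Y \<in> T ` ?W" by simp
  then obtain v where v: "v \<in> ?W" "T v = tup Y" by (rule imageE) simp
  have row_Y: "row v i = Y i" if "i < n" for i
    using blk_T[OF that, of v] blk_tup[of Y i] Ac[OF Y[OF that]] that v(2) by simp
  show thesis
  proof (rule that)
    show "j < n \<Longrightarrow> blk v j \<in> A" for j using v(1) by simp
    show "(\<Sum>j<n. \<Sum>r<n. blk v j $$ (p, r) * P j i $$ (r, s)) = Y i $$ (p, s)"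
      if "i < n" "p < n" "s < n" for i p s
      using row_index[OF that, of v] row_Y[OF that(1)] by simp
  qed
qed

text \<open>The matrix unit at \<open>(a, b)\<close> is \<open>\<Sum>\<^sub>j \<epsilon> j G\<^sub>j\<close>, where \<open>G\<close> solves \<open>G P = Y\<close> for the row \<open>Y\<close> whose \<open>b\<close>-th entry
  is \<open>R a\<close> and whose other entries vanish: apply this equation to the vector \<open>\<epsilon>\<close>.\<close>

lemma full_matrix_algebraI:
  fixes A :: "'k::field mat set" and P :: "nat \<Rightarrow> nat \<Rightarrow> 'k mat" and \<epsilon> :: "nat \<Rightarrow> 'k"
  assumes sub: "submodule class_ring A (module_mat TYPE('k) n n)"
    and mult: "\<And>X Y. \<lbrakk>X \<in> A; Y \<in> A\<rbrakk> \<Longrightarrow> X * Y \<in> A"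
    and P: "\<And>j i. \<lbrakk>j < n; i < n\<rbrakk> \<Longrightarrow> P j i \<in> A"
    and PQ: "\<And>j k r t. \<lbrakk>j < n; k < n; r < n; t < n\<rbrakk> \<Longrightarrow>
      (\<Sum>i<n. \<Sum>s<n. P j i $$ (r, s) * Q i k s t) = (if j = k \<and> r = t then 1 else 0)"
    and P\<epsilon>: "\<And>j i r. \<lbrakk>j < n; i < n; r < n\<rbrakk> \<Longrightarrow> (\<Sum>s<n. P j i $$ (r, s) * \<epsilon> s) = (if r = i then \<epsilon> j else 0)"
    and R: "\<And>a. a < n \<Longrightarrow> R a \<in> A"
    and R\<epsilon>: "\<And>a r. \<lbrakk>a < n; r < n\<rbrakk> \<Longrightarrow> (\<Sum>s<n. R a $$ (r, s) * \<epsilon> s) = (if r = a then 1 else 0)"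
  shows "A = carrier_mat n n"
proof -
  interpret A: LinearCombinations.submodule class_ring A "module_mat TYPE('k) n n" by (rule sub)
  have Ac: "X \<in> carrier_mat n n" if "X \<in> A" for X using A.subset that by (auto simp: module_mat_simps)
  have scale: "x \<cdot>\<^sub>m X \<in> A" if "X \<in> A" for x X using A.smult_closed[of x X] that by (simp add: module_mat_simps)
  have unit: "mat n n (\<lambda>x. if x = (a, b) then 1 else 0) \<in> A" if a: "a < n" and b: "b < n" for a b
  proof -
    have "(if i = b then 1 else 0) \<cdot>\<^sub>m R a \<in> A" for i by (rule scale[OF R[OF a]])
    then obtain G where G: "\<And>j. j < n \<Longrightarrow> G j \<in> A"
      and eq: "\<And>i p s. \<lbrakk>i < n; p < n; s < n\<rbrakk> \<Longrightarrow>
        (\<Sum>j<n. \<Sum>r<n. G j $$ (p, r) * P j i $$ (r, s)) = ((if i = b then 1 else 0) \<cdot>\<^sub>m R a) $$ (p, s)"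
      using block_row_equation_solvable[OF sub mult P PQ, of "\<lambda>i. (if i = b then 1 else 0) \<cdot>\<^sub>m R a"] by blast
    have "(\<Sum>j<n. (\<epsilon> j \<cdot>\<^sub>m G j) $$ (p, i)) = (if (p, i) = (a, b) then 1 else 0)" if p: "p < n" and i: "i < n" for p i
    proof -
      have "(\<Sum>j<n. (\<epsilon> j \<cdot>\<^sub>m G j) $$ (p, i)) = (\<Sum>j<n. \<epsilon> j * G j $$ (p, i))"
        using p i by (intro sum.cong refl) (simp add: carrier_matD[OF Ac[OF G]])
      also have "\<dots> = (\<Sum>j<n. \<Sum>r<n. G j $$ (p, r) * (if r = i then \<epsilon> j else 0))"
        using i by (intro sum.cong refl) (simp add: sum_mult_delta mult.commute)
      also have "\<dots> = (\<Sum>j<n. \<Sum>r<n. G j $$ (p, r) * (\<Sum>s<n. P j i $$ (r, s) * \<epsilon> s))"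
        using i P\<epsilon> by (intro sum.cong refl) auto
      also have "\<dots> = (\<Sum>j<n. \<Sum>s<n. \<Sum>r<n. G j $$ (p, r) * P j i $$ (r, s) * \<epsilon> s)"
        unfolding sum_distrib_left mult.assoc by (rule sum.cong[OF refl]) (rule sum.swap)
      also have "\<dots> = (\<Sum>s<n. (\<Sum>j<n. \<Sum>r<n. G j $$ (p, r) * P j i $$ (r, s)) * \<epsilon> s)"
        unfolding sum_distrib_right by (rule sum.swap)
      also have "\<dots> = (\<Sum>s<n. ((if i = b then 1 else 0) \<cdot>\<^sub>m R a) $$ (p, s) * \<epsilon> s)"
        using p i eq by simp
      also have "\<dots> = (if i = b then 1 else 0) * (\<Sum>s<n. R a $$ (p, s) * \<epsilon> s)"
        using Ac[OF R[OF a]] p by (simp add: sum_distrib_left mult.assoc)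
      finally show ?thesis using R\<epsilon>[OF a p] by auto
    qed
    then have "mat n n (\<lambda>x. if x = (a, b) then 1 else 0) = mat n n (\<lambda>x. \<Sum>j\<in>{..<n}. (\<epsilon> j \<cdot>\<^sub>m G j) $$ x)"
      by (intro eq_matI) auto
    also have "\<dots> \<in> A" by (rule submodule_mat_sum[OF sub]) (use G scale in auto)
    finally show ?thesis .
  qed
  have "X \<in> A" if X: "X \<in> carrier_mat n n" for X
  proof -
    have "(\<Sum>y\<in>{..<n} \<times> {..<n}. (X $$ y \<cdot>\<^sub>m mat n n (\<lambda>x. if x = y then 1 else 0)) $$ x) = X $$ x"
      if x: "x \<in> {..<n} \<times> {..<n}" for x
    proof -
      have "(\<Sum>y\<in>{..<n} \<times> {..<n}. (X $$ y \<cdot>\<^sub>m mat n n (\<lambda>x. if x = y then 1 else 0)) $$ x)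
        = (\<Sum>y\<in>{..<n} \<times> {..<n}. X $$ y * (if y = x then 1 else 0))"
        using x by (intro sum.cong refl) (auto split: if_splits)
      also have "\<dots> = X $$ x" using x by (subst sum_mult_delta) auto
      finally show ?thesis .
    qed
    then have "X = mat n n (\<lambda>x. \<Sum>y\<in>{..<n} \<times> {..<n}. (X $$ y \<cdot>\<^sub>m mat n n (\<lambda>x. if x = y then 1 else 0)) $$ x)"
      using X by (intro eq_matI) auto
    also have "\<dots> \<in> A"
      by (rule submodule_mat_sum[OF sub]) (auto intro!: scale unit)
    finally show ?thesis .
  qed
  then show ?thesis using Ac by blast
qed

section \<open>The isomorphism\<close>

lemma assoc_algebra_mat: "assoc_algebra (module_mat TYPE('k::field) n n)"
proof -
  interpret vectorspace class_ring "module_mat TYPE('k) n n" by (rule matrix_vs)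
  show ?thesis
    by unfold_locales
      (auto simp: module_mat_simps add_mult_distrib_mat mult_add_distrib_mat mult_smult_distrib mult_smult_assoc_mat)
qed

text \<open>An injective linear map that respects products and units reflects all algebra laws.\<close>

lemma assoc_algebra_transport:
  fixes A :: "('k::field, 'a, 'm) module_scheme" and B :: "('k, 'b, 'n) module_scheme"
  assumes "assoc_algebra B" and A: "module class_ring A" and f: "f \<in> linear_maps A B" and inj: "inj_on f (carrier A)"
    and closed: "\<And>x y. \<lbrakk>x \<in> carrier A; y \<in> carrier A\<rbrakk> \<Longrightarrow> x \<otimes>\<^bsub>A\<^esub> y \<in> carrier A" "\<one>\<^bsub>A\<^esub> \<in> carrier A"
    and mult: "\<And>x y. \<lbrakk>x \<in> carrier A; y \<in> carrier A\<rbrakk> \<Longrightarrow> f (x \<otimes>\<^bsub>A\<^esub> y) = f x \<otimes>\<^bsub>B\<^esub> f y"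
    and one: "f \<one>\<^bsub>A\<^esub> = \<one>\<^bsub>B\<^esub>"
  shows "assoc_algebra A"
proof -
  interpret B: assoc_algebra B by fact
  interpret A: Module.module class_ring A by fact
  note [simp] = A.smult_closed[simplified] closed linear_mapsD[OF f] mult one
  have eqI: "x = y" if "f x = f y" "x \<in> carrier A" "y \<in> carrier A" for x y
    using inj that by (rule inj_onD)
  show ?thesis
    by (intro assoc_algebra.intro vectorspace.intro A class_field ring.intro A.abelian_group_axioms
         monoid.intro ring_axioms.intro assoc_algebra_axioms.intro; (assumption | rule eqI)?)
      (auto simp: B.m_assoc B.l_distr B.r_distr B.smult_mult_left B.smult_mult_right)
qed

context based_hopf_algebra
begin

text \<open>The right inverse of the matrix with entries \<open>rep_matrix (e j) (c i)\<close> is the inverse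
  \<open>x \<otimes> y \<mapsto> x\<^sub>1 \<otimes> S x\<^sub>2 y\<close> of the Galois map in coordinates: its block \<open>(i, k)\<close> sends a functional \<open>g\<close> to
  \<open>w \<mapsto> g x\<^sub>1 c\<^sub>k (S x\<^sub>2 w)\<close> with \<open>x = e\<^sub>i\<close>.  The product of the two contracts to the identity by
  coassociativity, the antipode axiom and the counit axiom.\<close>

lemma rep_surjective: "rep ` carrier H = carrier_mat n n"
proof (rule full_matrix_algebraI[where P = "\<lambda>j i. rep_matrix (e j) (c i)" and R = "\<lambda>a. rep_matrix \<one> (c a)"
    and \<epsilon> = "\<lambda>s. counit L (e s)"
    and Q = "\<lambda>i k s t. sweedler (\<lambda>a b. c t a * c k (antipode L b \<otimes> e s)) (e i)"])
  interpret rep: mod_hom class_ring H M rep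
    by (intro mod_hom.intro mod_hom_axioms.intro LD.T.module_axioms module_module_mat rep_linear)
  show "submodule class_ring (rep ` carrier H) M" using rep.im_is_submodule by (simp add: rep.im_def)
  show "X * Y \<in> rep ` carrier H" if "X \<in> rep ` carrier H" "Y \<in> rep ` carrier H" for X Y
    using that heisenberg_mult_closed by (auto simp flip: rep_mult)
  show "rep_matrix (e j) (c i) \<in> rep ` carrier H" if "j < n" "i < n" for i j
    using that by (intro image_eqI[of _ _ "pure_tensor L D (e j) (c i)"] LD.pure_tensor_closed)
      (simp_all add: rep_pure basis_closed coord_closed)
  show "rep_matrix \<one> (c a) \<in> rep ` carrier H" if "a < n" for a
    using that by (intro image_eqI[of _ _ "pure_tensor L D \<one> (c a)"] LD.pure_tensor_closed)
      (simp_all add: rep_pure coord_closed)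
  show "(\<Sum>s<n. rep_matrix (e j) (c i) $$ (r, s) * counit L (e s)) = (if r = i then counit L (e j) else 0)"
    if "j < n" "i < n" "r < n" for j i r
  proof -
    note ci = coord_functional[OF that(2)] and ej = basis_closed[OF that(1)] and er = basis_closed[OF that(3)]
    have b: "bilinear_form (\<lambda>x y. c i x * counit L y)" by (rule product_form[OF ci counit_linear])
    have "(\<Sum>s<n. rep_matrix (e j) (c i) $$ (r, s) * counit L (e s)) = sweedler (\<lambda>x y. c i x * counit L (y \<otimes> e j)) (e r)"
      by (rule rep_matrix_action[OF ej ci counit_linear that(3)])
    also have "\<dots> = sweedler (\<lambda>x y. counit L (e j) * (c i x * counit L y)) (e r)"
      by (rule sweedler_cong[OF action_form[OF ci counit_linear ej] er]) (simp add: counit_mult ej)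
    also have "\<dots> = counit L (e j) * c i (e r)"
      by (simp add: sweedler_scale[OF b er] sweedler_counit_right[OF ci er])
    finally show ?thesis using that by (auto simp: coord_basis)
  qed
  show "(\<Sum>s<n. rep_matrix \<one> (c a) $$ (r, s) * counit L (e s)) = (if r = a then 1 else 0)" if "a < n" "r < n" for a r
  proof -
    note ca = coord_functional[OF that(1)] and er = basis_closed[OF that(2)]
    have "(\<Sum>s<n. rep_matrix \<one> (c a) $$ (r, s) * counit L (e s)) = sweedler (\<lambda>x y. c a x * counit L (y \<otimes> \<one>)) (e r)"
      by (rule rep_matrix_action[OF one_closed ca counit_linear that(2)])
    also have "\<dots> = sweedler (\<lambda>x y. c a x * counit L y) (e r)"
      by (rule sweedler_cong[OF action_form[OF ca counit_linear one_closed] er]) simp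
    also have "\<dots> = c a (e r)" by (rule sweedler_counit_right[OF ca er])
    finally show ?thesis using that by (auto simp: coord_basis)
  qed
  show "(\<Sum>i<n. \<Sum>s<n. rep_matrix (e j) (c i) $$ (r, s) * sweedler (\<lambda>a b. c t a * c k (antipode L b \<otimes> e s)) (e i))
      = (if j = k \<and> r = t then 1 else 0)" if "j < n" "k < n" "r < n" "t < n" for j k r t
  proof -
    note ck = coord_functional[OF that(2)] and ct = coord_functional[OF that(4)]
      and ej = basis_closed[OF that(1)] and er = basis_closed[OF that(3)]
    define g where "g w x = sweedler (\<lambda>a b. c t a * c k (antipode L b \<otimes> w)) x" for w x
    have gb: "bilinear_form (\<lambda>a b. c t a * c k (antipode L b \<otimes> w))" if "w \<in> carrier L" for w
      by (intro product_form ct linear_maps_comp[OF _ ck] linear_intros that)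
    have g1: "g w \<in> functionals L" if "w \<in> carrier L" for w
      unfolding g_def[abs_def] by (rule sweedler_linear[OF gb[OF that]])
    have g2: "(\<lambda>w. g w x) \<in> functionals L" if "x \<in> carrier L" for x
      unfolding g_def by (intro sweedler_linear_param module_axioms that gb linear_intros linear_maps_comp[OF _ ck] antipode_closed)
    have b1: "bilinear_form (\<lambda>x y. g (y \<otimes> e j) x)"
      by (intro bilinearI g1 linear_maps_comp[OF _ g2] linear_intros m_closed ej)
    have tri: "trilinear_form (\<lambda>x y z. c t x * c k (antipode L y \<otimes> (z \<otimes> e j)))"
      by (intro trilinear_formI linear_intros ct linear_maps_comp[OF _ ck] antipode_closed m_closed ej)
    have b2: "bilinear_form (\<lambda>x y. c t x * counit L y)" by (rule product_form[OF ct counit_linear])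
    have ckj: "(\<lambda>z. c k (z \<otimes> e j)) \<in> functionals L"
      by (intro linear_maps_comp[OF _ ck] linear_intros ej)
    have b3: "bilinear_form (\<lambda>a b. c k (antipode L a \<otimes> (b \<otimes> e j)))"
      by (intro bilinearI linear_maps_comp[OF _ ck] linear_intros antipode_closed m_closed ej)
    have "(\<Sum>i<n. \<Sum>s<n. rep_matrix (e j) (c i) $$ (r, s) * g (e s) (e i))
      = (\<Sum>i<n. sweedler (\<lambda>x y. c i x * g (y \<otimes> e j) (e i)) (e r))"
      by (intro sum.cong refl rep_matrix_action ej coord_functional g2 basis_closed that) simp_all
    also have "\<dots> = sweedler (\<lambda>x y. \<Sum>i<n. c i x * g (y \<otimes> e j) (e i)) (e r)"
    proof (rule sweedler_sum[OF _ er, symmetric])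
      show "bilinear_form (\<lambda>x y. c i x * g (y \<otimes> e j) (e i))" if "i \<in> {..<n}" for i
        using that by (intro action_form[OF coord_functional g2 ej] basis_closed) simp_all
    qed
    \<comment> \<open>The sum over \<open>i\<close> is the expansion of \<open>x\<close> in the basis \<open>e\<close>.\<close>
    also have "\<dots> = sweedler (\<lambda>x y. g (y \<otimes> e j) x) (e r)"
      by (rule sweedler_cong[OF b1 er, symmetric]) (simp add: functional_expand[OF g1] ej)
    also have "\<dots> = sweedler (\<lambda>x z. sweedler (\<lambda>a b. c t x * c k (antipode L a \<otimes> (b \<otimes> e j))) z) (e r)"
      unfolding g_def by (rule sweedler_coassoc[OF tri er])
    also have "\<dots> = sweedler (\<lambda>x z. c k (e j) * (c t x * counit L z)) (e r)"
    proof (rule sweedler_cong[OF _ er, symmetric])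
      show "bilinear_form (\<lambda>x z. c k (e j) * (c t x * counit L z))"
        by (intro bilinearI functional_mult_left bilinearD[OF b2])
      fix x z assume x: "x \<in> carrier L" and z: "z \<in> carrier L"
      have "sweedler (\<lambda>a b. c k (antipode L a \<otimes> (b \<otimes> e j))) z = sweedler (\<lambda>a b. c k ((antipode L a \<otimes> b) \<otimes> e j)) z"
        by (rule sweedler_cong[OF b3 z]) (simp add: m_assoc ej)
      also have "\<dots> = counit L z * c k (e j)"
        using sweedler_antipode_left[OF ckj z] ej by simp
      finally show "c k (e j) * (c t x * counit L z) = sweedler (\<lambda>a b. c t x * c k (antipode L a \<otimes> (b \<otimes> e j))) z"
        by (simp add: sweedler_scale[OF b3 z])
    qed
    also have "\<dots> = c k (e j) * c t (e r)"
      by (simp add: sweedler_scale[OF b2 er] sweedler_counit_right[OF ct er])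
    finally show ?thesis using that by (auto simp: coord_basis g_def)
  qed
qed

lemma tensor_space_vectorspace: "vectorspace class_ring H"
  by (intro vectorspace.intro LD.T.module_axioms class_field)

text \<open>The \<open>n\<^sup>2\<close> tensors of basis elements generate, as one sees by fixing one factor at a time.\<close>

lemma tensor_space_dim: "vectorspace.fin_dim class_ring H" "vectorspace.dim class_ring H \<le> n * n"
proof -
  interpret H: vectorspace class_ring H by (rule tensor_space_vectorspace)
  define S where "S = (\<lambda>(j, i). pure_tensor L D (e j) (c i)) ` ({..<n} \<times> {..<n})"
  have S: "finite S" "card S \<le> n * n" "S \<subseteq> carrier H"
    using card_image_le[of "{..<n} \<times> {..<n}" "\<lambda>(j, i). pure_tensor L D (e j) (c i)"]
    by (auto simp: S_def intro!: LD.pure_tensor_closed basis_closed coord_closed)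
  have sub: "submodule class_ring (LD.T.span S) H" by (rule LD.T.span_is_submodule[OF S(3)])
  have 1: "pure_tensor L D u (c i) \<in> LD.T.span S" if i: "i < n" and u: "u \<in> carrier L" for u i
  proof -
    have "{u \<in> carrier L. pure_tensor L D u (c i) \<in> LD.T.span S} = carrier L"
    proof (rule basis_generates)
      show "submodule class_ring {u \<in> carrier L. pure_tensor L D u (c i) \<in> LD.T.span S} L"
        by (rule linear_maps_preimage_submodule[OF module_axioms LD.T.module_axioms
            bilinearD(2)[OF LD.pure_tensor_bilinear coord_closed[OF i]] sub])
      show "e j \<in> {u \<in> carrier L. pure_tensor L D u (c i) \<in> LD.T.span S}" if "j < n" for j
        using LD.T.in_own_span[OF S(3)] that i by (auto simp: S_def basis_closed)
    qed
    then show ?thesis using u by blast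
  qed
  have 2: "pure_tensor L D u f \<in> LD.T.span S" if u: "u \<in> carrier L" and f: "f \<in> carrier D" for u f
  proof -
    have "{f \<in> carrier D. pure_tensor L D u f \<in> LD.T.span S} = carrier D"
    proof (rule dual_generated)
      show "submodule class_ring {f \<in> carrier D. pure_tensor L D u f \<in> LD.T.span S} D"
        by (rule linear_maps_preimage_submodule[OF D.module_axioms LD.T.module_axioms
            bilinearD(1)[OF LD.pure_tensor_bilinear u] sub])
      show "c i \<in> {f \<in> carrier D. pure_tensor L D u f \<in> LD.T.span S}" if "i < n" for i
        using 1[OF that u] by (simp add: coord_closed that)
    qed
    then show ?thesis using f by blast
  qed
  have gen: "LD.T.span S = carrier H" by (rule LD.tensor_submodule_full[OF sub 2])
  show "H.fin_dim" unfolding H.fin_dim_def using S gen by blast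
  show "H.dim \<le> n * n" using H.gen_ge_dim[OF S(1,3) gen] S(2) by simp
qed

lemma rep_injective: "inj_on rep (carrier H)"
proof -
  interpret H: vectorspace class_ring H by (rule tensor_space_vectorspace)
  interpret M: vectorspace class_ring M by (rule matrix_vs)
  interpret rep: linear_map class_ring H M rep
    by (intro linear_map.intro mod_hom.intro mod_hom_axioms.intro H.vectorspace_axioms M.vectorspace_axioms
        LD.T.module_axioms module_module_mat rep_linear)
  show ?thesis
    using tensor_space_dim
    by (intro rep.surjective_dim_le_injective) (simp_all add: rep_surjective module_mat_simps dim_module_mat)
qed

lemma module_heisenberg_double: "module class_ring HD"
proof -
  have "v \<oplus>\<^bsub>H\<^esub> (\<ominus>\<^bsub>H\<^esub> v) = \<zero>\<^bsub>H\<^esub>" "\<ominus>\<^bsub>H\<^esub> v \<in> carrier H" if "v \<in> carrier H" for v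
    using that by (simp_all add: LD.T.r_neg)
  then have "\<forall>v\<in>carrier HD. \<exists>w\<in>carrier HD. v \<oplus>\<^bsub>HD\<^esub> w = \<zero>\<^bsub>HD\<^esub>"
    unfolding heisenberg_double_simps by blast
  then show ?thesis
    by (intro module_criteria)
      (auto simp: heisenberg_double_simps LD.T.a_ac LD.T.smult_closed[simplified] class_cring.cring_axioms
        LD.T.smult_l_distr[simplified] LD.T.smult_r_distr[simplified] LD.T.smult_assoc1[simplified] LD.T.smult_one[simplified])
qed

theorem rep_algebra_iso: "algebra_iso HD M rep"
proof -
  have lin: "rep \<in> linear_maps HD M"
    using rep_linear by (simp add: LinearCombinations.module_hom_def heisenberg_double_simps)
  have one: "\<one>\<^bsub>HD\<^esub> \<in> carrier HD"
    by (simp add: heisenberg_double_simps LD.pure_tensor_closed dual_one_closed)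
  have add: "rep (s \<oplus>\<^bsub>HD\<^esub> t) = rep s + rep t" if "s \<in> carrier H" "t \<in> carrier H" for s t
    using linear_mapsD(2)[OF rep_linear that] by (simp add: heisenberg_double_simps module_mat_simps)
  interpret M: assoc_algebra M by (rule assoc_algebra_mat)
  have "assoc_algebra HD"
  proof (rule assoc_algebra_transport[OF assoc_algebra_mat module_heisenberg_double lin])
    show "inj_on rep (carrier HD)" using rep_injective by (simp add: heisenberg_double_simps(1))
    show "x \<otimes>\<^bsub>HD\<^esub> y \<in> carrier HD" "rep (x \<otimes>\<^bsub>HD\<^esub> y) = rep x \<otimes>\<^bsub>M\<^esub> rep y"
      if "x \<in> carrier HD" "y \<in> carrier HD" for x y
      using that heisenberg_mult_closed[of x y] rep_mult[of x y]
      unfolding heisenberg_double_simps(1) by (simp_all add: module_mat_simps)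
  qed (simp_all add: one rep_one module_mat_simps)
  moreover have "rep \<in> QuotRing.ring_iso HD M"
  proof (rule ring_iso_memI)
    show "bij_betw rep (carrier HD) (carrier M)"
      using rep_injective rep_surjective by (simp add: bij_betw_def heisenberg_double_simps(1) module_mat_simps)
  qed (simp_all add: heisenberg_double_simps(1) module_mat_simps rep_closed rep_mult rep_one add)
  ultimately show ?thesis
    by (intro algebra_iso.intro algebra_iso_axioms.intro assoc_algebra_mat lin)
qed

end

theorem proposition1p1:
  fixes L :: "('k::field, 'a, 'm) hopf_scheme"
  assumes "hopf_algebra L"
    and "vectorspace.fin_dim class_ring L"
  shows "\<exists>\<phi>. algebra_iso (heisenberg_double L)
    (module_mat TYPE('k) (vectorspace.dim class_ring L) (vectorspace.dim class_ring L)) \<phi>"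
proof -
  interpret hopf_algebra L by fact
  obtain e c where e: "\<And>i. i < dim \<Longrightarrow> e i \<in> carrier L"
    and c: "\<And>i. i < dim \<Longrightarrow> c i \<in> functionals L"
    and ce: "\<And>i j. \<lbrakk>i < dim; j < dim\<rbrakk> \<Longrightarrow> c i (e j) = (if i = j then 1 else 0)"
    and gen: "\<And>N. \<lbrakk>submodule class_ring N L; \<And>i. i < dim \<Longrightarrow> e i \<in> N\<rbrakk> \<Longrightarrow> N = carrier L"
    by (rule dual_basis_exists[OF vectorspace_axioms assms(2)]) blast
  interpret based_hopf_algebra L dim e "\<lambda>i. restrict (c i) (carrier L)"
    by unfold_locales (simp_all add: e restrict_in_dual c ce gen)
  show ?thesis using rep_algebra_iso by blast
qed

end
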